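(* The inference system $\mathbf{ReC}_\lor$ admits equational derivability (ED). That is, for every substitution $\theta$, every set of equations $\mathcal{C}$, every equation $l\simeq r$ and every clause $D[l\theta]$: if $\mathcal{C}\vdash^*_{\mathbf{ReC}_\lor} D[l\theta]$, then $\mathcal{C},\,l\simeq r\vdash^*_{\mathbf{ReC}_\lor} D[r\theta]$.
   Context: Setting: (many-sorted) first-order logic with equality $\simeq$. Equations are unordered, so a rule stated for $l\simeq r$ can be applied with either side as $l$. $\bowtie$ stands for $\simeq$ or $\not\simeq$. A clause is a disjunction of literals. $E[s]$ denotes an expression $E$ with a distinguished occurrence of the term $s$, and $E[t]$ is the result of replacing this occurrence by $t$. $\succ$ is a fixed reduction ordering (well-founded, stable under substitutions and contexts) that is total on ground terms; it is extended to literals and clauses by the bag (multiset) extension. A literal selection function satisfying the usual condition w.r.t. $\succ$ for superposition is fixed. For an inference system $\mathcal{I}$, $\mathcal{C}\vdash^*_{\mathcal{I}}D$ means that $D$ is derivable from the clauses $\mathcal{C}$ by finitely many inferences of $\mathcal{I}$. Annotations: every clause carries an annotation, either ${}^{\blacksquare}C$ (result of an upward rewrite) or ${}^{\square}C$ (any other clause). Input clauses are annotated $\square$. An unannotated clause counts as derivable if it is derivable with at least one of the two annotations. $\mathbf{ReC}_\lor$ consists of the following rules. (Sup) From ${}^{\square}(s[u]\bowtie t\lor C)$ and ${}^{\square}(l\simeq r\lor D)$ (displayed literals selected) infer ${}^{\square}(s[r]\bowtie t\lor C\lor D)\theta$, where $u$ is not a variable, $\theta=\mathrm{mgu}(l,u)$,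 $r\theta\not\succeq l\theta$ and $t\theta\not\succeq s\theta$. (EqRes) From ${}^{\square}(s\not\simeq t\lor C)$ ($s\not\simeq t$ selected) infer ${}^{\square}C\theta$, where $\theta=\mathrm{mgu}(s,t)$. (EqFac) From ${}^{\square}(s\simeq t\lor u\simeq w\lor C)$ (both displayed literals selected) infer ${}^{\square}(s\simeq t\lor t\not\simeq w\lor C)\theta$, where $\theta=\mathrm{mgu}(s,u)$, $t\theta\not\succeq s\theta$ and $w\theta\not\succeq t\theta$. ($\mathrm{Rw}_\downarrow$) From ${}^{\square}C[l\theta]$ and ${}^{\square}(l\simeq r)$ infer ${}^{\square}C[r\theta]$, where $\theta$ is a substitution with $l\theta\not\preceq r\theta$. ($\mathrm{Rw}_\uparrow$) From $C[l\theta]$ with either annotation and ${}^{\square}(l\simeq r)$ infer ${}^{\blacksquare}C[r\theta]$, where $\theta$ is a substitution with $l\theta\not\succeq r\theta$. *)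

theory Defs
  imports Main "HOL-Library.Multiset" "HOL-Library.Multiset_Order" "HOL-Library.Uprod"
begin

text \<open>A variable carries its sort; there are countably infinitely many variables of each sort.
  A signature assigns argument sorts and a result sort to each function symbol.
  Raw terms may be ill-sorted; \<open>has_sort\<close> singles out the terms proper.
  The unsorted setting is the instance where \<open>'s\<close> is \<open>unit\<close>.\<close>

type_synonym 's var = "nat \<times> 's"
type_synonym ('f, 's) signature = "'f \<Rightarrow> 's list \<times> 's"

datatype ('f, 's) trm = Var "'s var" | Fun 'f "('f, 's) trm list"

inductive has_sort :: "('f, 's) signature \<Rightarrow> ('f, 's) trm \<Rightarrow> 's \<Rightarrow> bool"
  for sig :: "('f, 's) signature" where
  "has_sort sig (Var (n, s)) s"
| "sig f = (ss, s) \<Longrightarrow> list_all2 (has_sort sig) ts ss \<Longrightarrow> has_sort sig (Fun f ts) s"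

definition wt_terms :: "('f, 's) signature \<Rightarrow> ('f, 's) trm set" where
  "wt_terms sig = {t. \<exists>s. has_sort sig t s}"

fun vars_term :: "('f, 's) trm \<Rightarrow> 's var set" where
  "vars_term (Var x) = {x}"
| "vars_term (Fun f ts) = (\<Union>t \<in> set ts. vars_term t)"

definition ground_terms :: "('f, 's) signature \<Rightarrow> ('f, 's) trm set" where
  "ground_terms sig = {t \<in> wt_terms sig. vars_term t = {}}"

text \<open>The usual convention that every sort has a nonempty Herbrand universe.\<close>

definition sorts_inhabited :: "('f, 's) signature \<Rightarrow> bool" where
  "sorts_inhabited sig \<longleftrightarrow> (\<forall>s. \<exists>t \<in> ground_terms sig. has_sort sig t s)"

type_synonym ('f, 's) subst = "'s var \<Rightarrow> ('f, 's) trm"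

definition wt_subst :: "('f, 's) signature \<Rightarrow> ('f, 's) subst \<Rightarrow> bool" where
  "wt_subst sig \<sigma> \<longleftrightarrow> (\<forall>x. has_sort sig (\<sigma> x) (snd x))"

fun subst_term :: "('f, 's) trm \<Rightarrow> ('f, 's) subst \<Rightarrow> ('f, 's) trm" (infixl "\<cdot>" 75) where
  "Var x \<cdot> \<sigma> = \<sigma> x"
| "Fun f ts \<cdot> \<sigma> = Fun f (map (\<lambda>t. t \<cdot> \<sigma>) ts)"

definition is_renaming :: "('f, 's) subst \<Rightarrow> bool" where
  "is_renaming \<rho> \<longleftrightarrow> (\<exists>\<pi>. bij \<pi> \<and> (\<forall>x. snd (\<pi> x) = snd x) \<and> \<rho> = (\<lambda>x. Var (\<pi> x)))"

definition is_unifier ::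
  "('f, 's) signature \<Rightarrow> ('f, 's) subst \<Rightarrow> ('f, 's) trm \<Rightarrow> ('f, 's) trm \<Rightarrow> bool" where
  "is_unifier sig \<sigma> s t \<longleftrightarrow> wt_subst sig \<sigma> \<and> s \<cdot> \<sigma> = t \<cdot> \<sigma>"

definition is_mgu ::
  "('f, 's) signature \<Rightarrow> ('f, 's) subst \<Rightarrow> ('f, 's) trm \<Rightarrow> ('f, 's) trm \<Rightarrow> bool" where
  "is_mgu sig \<sigma> s t \<longleftrightarrow> is_unifier sig \<sigma> s t \<and>
     (\<forall>\<tau>. is_unifier sig \<tau> s t \<longrightarrow> (\<exists>\<delta>. wt_subst sig \<delta> \<and> (\<forall>x. \<tau> x = \<sigma> x \<cdot> \<delta>)))"

datatype ('f, 's) ctxt =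
    Hole
  | More 'f "('f, 's) trm list" "('f, 's) ctxt" "('f, 's) trm list"

fun fill :: "('f, 's) ctxt \<Rightarrow> ('f, 's) trm \<Rightarrow> ('f, 's) trm" where
  "fill Hole t = t"
| "fill (More f ts K us) t = Fun f (ts @ fill K t # us)"

text \<open>Equations are unordered pairs, so every rule below that mentions \<open>Lit p s t\<close> applies
  with the two sides in either order. The flag is \<open>True\<close> for positive literals; a variable
  in its place plays the role of an equality sign of unspecified polarity.\<close>

datatype ('f, 's) literal = Literal (is_pos: bool) (equation: "('f, 's) trm uprod")

abbreviation Lit :: "bool \<Rightarrow> ('f, 's) trm \<Rightarrow> ('f, 's) trm \<Rightarrow> ('f, 's) literal" where
  "Lit p s t \<equiv> Literal p (Upair s t)"

type_synonym ('f, 's) clause = "('f, 's) literal multiset"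

fun subst_lit :: "('f, 's) literal \<Rightarrow> ('f, 's) subst \<Rightarrow> ('f, 's) literal" (infixl "\<cdot>l" 75) where
  "Literal p e \<cdot>l \<sigma> = Literal p (map_uprod (\<lambda>t. t \<cdot> \<sigma>) e)"

definition subst_clause :: "('f, 's) clause \<Rightarrow> ('f, 's) subst \<Rightarrow> ('f, 's) clause"
    (infixl "\<cdot>c" 75) where
  "C \<cdot>c \<sigma> = image_mset (\<lambda>L. L \<cdot>l \<sigma>) C"

definition vars_clause :: "('f, 's) clause \<Rightarrow> 's var set" where
  "vars_clause C = (\<Union>L \<in> set_mset C. \<Union>t \<in> set_uprod (equation L). vars_term t)"

definition wt_literal :: "('f, 's) signature \<Rightarrow> ('f, 's) literal \<Rightarrow> bool" where
  "wt_literal sig L \<longleftrightarrow> (\<exists>s. \<forall>t \<in> set_uprod (equation L). has_sort sig t s)"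

definition wt_clause :: "('f, 's) signature \<Rightarrow> ('f, 's) clause \<Rightarrow> bool" where
  "wt_clause sig C \<longleftrightarrow> (\<forall>L \<in># C. wt_literal sig L)"

definition is_equation_clause :: "('f, 's) signature \<Rightarrow> ('f, 's) clause \<Rightarrow> bool" where
  "is_equation_clause sig C \<longleftrightarrow> wt_clause sig C \<and> (\<exists>s t. C = {#Lit True s t#})"

text \<open>A clause with one distinguished term occurrence: the polarity of the literal with the
  hole, the side with the hole, the other side, and the remaining literals.\<close>

datatype ('f, 's) clause_ctxt =
  Clause_Ctxt bool "('f, 's) ctxt" "('f, 's) trm" "('f, 's) clause"

fun fill_clause :: "('f, 's) clause_ctxt \<Rightarrow> ('f, 's) trm \<Rightarrow> ('f, 's) clause" where
  "fill_clause (Clause_Ctxt p K t C) u = add_mset (Lit p (fill K u) t) C"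

definition reduction_ordering ::
  "('f, 's) signature \<Rightarrow> (('f, 's) trm \<Rightarrow> ('f, 's) trm \<Rightarrow> bool) \<Rightarrow> bool" where
  "reduction_ordering sig gt \<longleftrightarrow>
     irreflp_on (wt_terms sig) gt \<and>
     transp_on (wt_terms sig) gt \<and>
     wfp_on (wt_terms sig) (\<lambda>s t. gt t s) \<and>
     (\<forall>s \<in> wt_terms sig. \<forall>t \<in> wt_terms sig. \<forall>\<sigma>.
        wt_subst sig \<sigma> \<longrightarrow> gt s t \<longrightarrow> gt (s \<cdot> \<sigma>) (t \<cdot> \<sigma>)) \<and>
     (\<forall>K s t. fill K s \<in> wt_terms sig \<longrightarrow> fill K t \<in> wt_terms sig \<longrightarrow>
        gt s t \<longrightarrow> gt (fill K s) (fill K t))"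

definition total_on_ground ::
  "('f, 's) signature \<Rightarrow> (('f, 's) trm \<Rightarrow> ('f, 's) trm \<Rightarrow> bool) \<Rightarrow> bool" where
  "total_on_ground sig gt \<longleftrightarrow> totalp_on (ground_terms sig) gt"

abbreviation ge_of :: "(('f, 's) trm \<Rightarrow> ('f, 's) trm \<Rightarrow> bool) \<Rightarrow>
    ('f, 's) trm \<Rightarrow> ('f, 's) trm \<Rightarrow> bool" where
  "ge_of gt s t \<equiv> gt s t \<or> s = t"

lift_definition mset_uprod :: "'a uprod \<Rightarrow> 'a multiset" is "\<lambda>(x, y). {#x, y#}"
  by (auto simp: eq_upair_def add_mset_commute)

text \<open>A positive literal with sides \<open>s\<close>, \<open>t\<close> is the bag \<open>{s, t}\<close>, and a negative one is
  \<open>{s, s, t, t}\<close>. Literals are compared by the Dershowitz--Manna bag extension.\<close>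

definition mset_lit :: "('f, 's) literal \<Rightarrow> ('f, 's) trm multiset" where
  "mset_lit L = (if is_pos L then mset_uprod (equation L)
                 else mset_uprod (equation L) + mset_uprod (equation L))"

definition lit_gt :: "(('f, 's) trm \<Rightarrow> ('f, 's) trm \<Rightarrow> bool) \<Rightarrow>
    ('f, 's) literal \<Rightarrow> ('f, 's) literal \<Rightarrow> bool" where
  "lit_gt gt L L' \<longleftrightarrow> multp\<^sub>D\<^sub>M (\<lambda>s t. gt t s) (mset_lit L') (mset_lit L)"

definition maximal_lits ::
  "(('f, 's) trm \<Rightarrow> ('f, 's) trm \<Rightarrow> bool) \<Rightarrow> ('f, 's) clause \<Rightarrow> ('f, 's) clause" where
  "maximal_lits gt C = {#L \<in># C. \<not> (\<exists>L' \<in># C. lit_gt gt L' L)#}"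

definition admissible_selection ::
  "('f, 's) signature \<Rightarrow> (('f, 's) trm \<Rightarrow> ('f, 's) trm \<Rightarrow> bool) \<Rightarrow>
   (('f, 's) clause \<Rightarrow> ('f, 's) clause) \<Rightarrow> bool" where
  "admissible_selection sig gt sel \<longleftrightarrow>
     (\<forall>C. wt_clause sig C \<and> C \<noteq> {#} \<longrightarrow>
        sel C \<subseteq># C \<and> sel C \<noteq> {#} \<and>
        ((\<exists>L \<in># sel C. \<not> is_pos L) \<or> maximal_lits gt C \<subseteq># sel C))"

text \<open>\<open>Upward\<close> annotates results of upward rewrites, \<open>Plain\<close> all other clauses.\<close>

datatype annotation = Plain | Upward

text \<open>The premises of superposition are standardised apart by a renaming of the second one;
  selection refers to the premises as derived.\<close>

inductive rec_derives ::
  "('f, 's) signature \<Rightarrow> (('f, 's) trm \<Rightarrow> ('f, 's) trm \<Rightarrow> bool) \<Rightarrow>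
   (('f, 's) clause \<Rightarrow> ('f, 's) clause) \<Rightarrow> ('f, 's) clause set \<Rightarrow>
   annotation \<Rightarrow> ('f, 's) clause \<Rightarrow> bool"
  for sig :: "('f, 's) signature"
    and gt :: "('f, 's) trm \<Rightarrow> ('f, 's) trm \<Rightarrow> bool"
    and sel :: "('f, 's) clause \<Rightarrow> ('f, 's) clause"
    and N :: "('f, 's) clause set" where
  Input: "C \<in> N \<Longrightarrow> rec_derives sig gt sel N Plain C"
| Sup: "rec_derives sig gt sel N Plain P \<Longrightarrow> rec_derives sig gt sel N Plain Q \<Longrightarrow>
    P = add_mset (Lit p (fill K u) t) C \<Longrightarrow> Lit p (fill K u) t \<in># sel P \<Longrightarrow>
    Q = add_mset (Lit True l' r') D' \<Longrightarrow> Lit True l' r' \<in># sel Q \<Longrightarrow>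
    is_renaming \<rho> \<Longrightarrow> vars_clause P \<inter> vars_clause (Q \<cdot>c \<rho>) = {} \<Longrightarrow>
    l = l' \<cdot> \<rho> \<Longrightarrow> r = r' \<cdot> \<rho> \<Longrightarrow> D = D' \<cdot>c \<rho> \<Longrightarrow>
    \<nexists>x. u = Var x \<Longrightarrow> is_mgu sig \<theta> l u \<Longrightarrow>
    \<not> ge_of gt (r \<cdot> \<theta>) (l \<cdot> \<theta>) \<Longrightarrow> \<not> ge_of gt (t \<cdot> \<theta>) (fill K u \<cdot> \<theta>) \<Longrightarrow>
    rec_derives sig gt sel N Plain (add_mset (Lit p (fill K r) t) (C + D) \<cdot>c \<theta>)"
| EqRes: "rec_derives sig gt sel N Plain P \<Longrightarrow>
    P = add_mset (Lit False s t) C \<Longrightarrow> Lit False s t \<in># sel P \<Longrightarrow>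
    is_mgu sig \<theta> s t \<Longrightarrow>
    rec_derives sig gt sel N Plain (C \<cdot>c \<theta>)"
| EqFac: "rec_derives sig gt sel N Plain P \<Longrightarrow>
    P = {#Lit True s t, Lit True u w#} + C \<Longrightarrow> {#Lit True s t, Lit True u w#} \<subseteq># sel P \<Longrightarrow>
    is_mgu sig \<theta> s u \<Longrightarrow>
    \<not> ge_of gt (t \<cdot> \<theta>) (s \<cdot> \<theta>) \<Longrightarrow> \<not> ge_of gt (w \<cdot> \<theta>) (t \<cdot> \<theta>) \<Longrightarrow>
    rec_derives sig gt sel N Plain (({#Lit True s t, Lit False t w#} + C) \<cdot>c \<theta>)"
| RwDown: "rec_derives sig gt sel N Plain (fill_clause E (l \<cdot> \<theta>)) \<Longrightarrow>
    rec_derives sig gt sel N Plain {#Lit True l r#} \<Longrightarrow>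
    wt_subst sig \<theta> \<Longrightarrow> \<not> ge_of gt (r \<cdot> \<theta>) (l \<cdot> \<theta>) \<Longrightarrow>
    rec_derives sig gt sel N Plain (fill_clause E (r \<cdot> \<theta>))"
| RwUp: "rec_derives sig gt sel N a (fill_clause E (l \<cdot> \<theta>)) \<Longrightarrow>
    rec_derives sig gt sel N Plain {#Lit True l r#} \<Longrightarrow>
    wt_subst sig \<theta> \<Longrightarrow> \<not> ge_of gt (l \<cdot> \<theta>) (r \<cdot> \<theta>) \<Longrightarrow>
    rec_derives sig gt sel N Upward (fill_clause E (r \<cdot> \<theta>))"

definition rec_derivable ::
  "('f, 's) signature \<Rightarrow> (('f, 's) trm \<Rightarrow> ('f, 's) trm \<Rightarrow> bool) \<Rightarrow>
   (('f, 's) clause \<Rightarrow> ('f, 's) clause) \<Rightarrow> ('f, 's) clause set \<Rightarrow> ('f, 's) clause \<Rightarrow> bool" where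
  "rec_derivable sig gt sel N C \<longleftrightarrow> (\<exists>a. rec_derives sig gt sel N a C)"

definition admits_ED ::
  "('f, 's) signature \<Rightarrow> (('f, 's) clause set \<Rightarrow> ('f, 's) clause \<Rightarrow> bool) \<Rightarrow> bool" where
  "admits_ED sig derivable \<longleftrightarrow>
     (\<forall>\<theta> N l r D.
        wt_subst sig \<theta> \<longrightarrow>
        (\<forall>C \<in> N. is_equation_clause sig C) \<longrightarrow>
        is_equation_clause sig {#Lit True l r#} \<longrightarrow>
        wt_clause sig (fill_clause D (l \<cdot> \<theta>)) \<longrightarrow>
        derivable N (fill_clause D (l \<cdot> \<theta>)) \<longrightarrow>
        derivable (insert {#Lit True l r#} N) (fill_clause D (r \<cdot> \<theta>)))"

end

theory Submission
  imports Defs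
begin

text \<open>A plain equation may be rewritten downwards and stays plain, and any derived equation may be
  rewritten upwards. So everything convertible with a plain equation is derivable once every
  conversion is a valley: downward steps followed by upward steps. This is the
  Church--Rosser property of ordered rewriting with the set of plain-derivable equations, which is
  closed under ordered critical pairs because of (Sup). From equations only equations are derived, so
  selection is trivial. Clauses may contain variables, on which \<open>\<succ>\<close> is partial; the confluence
  argument therefore runs with a total refinement of \<open>\<succ>\<close>, which is harmless because an oriented
  step of the refinement is never a wrong-way step of \<open>\<succ>\<close>.\<close>

section \<open>Sorts, substitutions and contexts\<close>

text \<open>The obstacle is that an upward result can neither be rewritten downwards again nor serve
  as a rule. If \<open>D[l\<theta>]\<close> is such a result and
  \<open>l\<theta> \<succ> r\<theta>\<close>, its derivation cannot simply be extended;
  \<open>D[r\<theta>]\<close> has to be reached anew from some plain equation. All that is kept of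
  the given derivation is therefore a plain equation together with a conversion of each of its
  sides. Convertibility of the two sides with each other would be too weak an invariant: trivial
  equations such as \<open>c \<simeq> c\<close> need not be derivable.

  The total refinement cannot be stable under substitutions, since swapping two variables of one
  sort would reverse their order. Hence each instance of an equation is oriented on its own, and
  critical pairs are considered for instances. Lifting them to (Sup) only uses stability of
  \<open>\<succ>\<close>.\<close>

lemma has_sort_Var: "has_sort sig (Var x) s \<longleftrightarrow> snd x = s"
  by (cases x) (auto elim: has_sort.cases intro: has_sort.intros)

lemma has_sort_Fun:
  "has_sort sig (Fun f ts) s \<longleftrightarrow> snd (sig f) = s \<and> list_all2 (has_sort sig) ts (fst (sig f))"
  by (auto elim: has_sort.cases intro: has_sort.intros simp: prod_eq_iff)

lemma has_sort_unique: "has_sort sig t a \<Longrightarrow> has_sort sig t b \<Longrightarrow> a = b"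
  by (cases t) (auto simp: has_sort_Var has_sort_Fun)

lemma has_sort_wt_subst: "wt_subst sig \<sigma> \<Longrightarrow> has_sort sig (\<sigma> x) (snd x)"
  by (simp add: wt_subst_def del: split_paired_All)

lemma has_sort_subst:
  assumes "wt_subst sig \<sigma>"
  shows "has_sort sig t a \<Longrightarrow> has_sort sig (t \<cdot> \<sigma>) a"
proof (induction t arbitrary: a)
  case (Var x)
  then show ?case using has_sort_wt_subst[OF assms, of x] by (simp add: has_sort_Var)
next
  case (Fun f ts)
  then show ?case by (auto simp: has_sort_Fun list_all2_conv_all_nth)
qed

lemma has_sort_fill_replace:
  "has_sort sig (fill K t) a \<Longrightarrow> has_sort sig t b \<Longrightarrow> has_sort sig t' b \<Longrightarrow> has_sort sig (fill K t') a"
proof (induction K arbitrary: a)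
  case (More f ts K us)
  obtain as b bs where *: "fst (sig f) = as @ b # bs" "list_all2 (has_sort sig) ts as"
      "has_sort sig (fill K t) b" "list_all2 (has_sort sig) us bs"
    using More.prems by (auto simp: has_sort_Fun list_all2_append1 list_all2_Cons1)
  have "list_all2 (has_sort sig) (ts @ fill K t' # us) (as @ b # bs)"
    using * More.IH[OF *(3) More.prems(2,3)] by (intro list_all2_appendI) auto
  then show ?case using More.prems(1) * by (simp add: has_sort_Fun)
qed (auto dest: has_sort_unique)

lemma has_sort_fill_hole: "has_sort sig (fill K t) a \<Longrightarrow> \<exists>b. has_sort sig t b"
  by (induction K arbitrary: a) (auto simp: has_sort_Fun list_all2_append1 list_all2_Cons1)

lemma subst_cong: "(\<And>x. x \<in> vars_term t \<Longrightarrow> \<sigma> x = \<tau> x) \<Longrightarrow> t \<cdot> \<sigma> = t \<cdot> \<tau>"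
  by (induction t) auto

lemma subst_subst: "t \<cdot> \<sigma> \<cdot> \<tau> = t \<cdot> (\<lambda>x. \<sigma> x \<cdot> \<tau>)"
  by (induction t) auto

lemma wt_subst_comp: "wt_subst sig \<sigma> \<Longrightarrow> wt_subst sig \<tau> \<Longrightarrow> wt_subst sig (\<lambda>x. \<sigma> x \<cdot> \<tau>)"
  by (auto simp: wt_subst_def intro!: has_sort_subst)

lemma wt_subst_Var: "wt_subst sig Var"
  by (auto simp: wt_subst_def has_sort_Var)

lemma finite_vars_term: "finite (vars_term t)"
  by (induction t) auto

lemma vars_term_subst: "vars_term (t \<cdot> \<sigma>) = (\<Union>x\<in>vars_term t. vars_term (\<sigma> x))"
  by (induction t) auto

section \<open>Contexts and overlapping occurrences\<close>

fun subst_ctxt :: "('f, 's) ctxt \<Rightarrow> ('f, 's) subst \<Rightarrow> ('f, 's) ctxt" where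
  "subst_ctxt Hole \<sigma> = Hole"
| "subst_ctxt (More f ts K us) \<sigma> =
     More f (map (\<lambda>t. t \<cdot> \<sigma>) ts) (subst_ctxt K \<sigma>) (map (\<lambda>t. t \<cdot> \<sigma>) us)"

lemma subst_fill: "fill K t \<cdot> \<sigma> = fill (subst_ctxt K \<sigma>) (t \<cdot> \<sigma>)"
  by (induction K) auto

lemma vars_term_fill_hole: "vars_term u \<subseteq> vars_term (fill K u)"
  by (induction K) auto

lemma subst_ctxt_cong:
  "(\<And>x. x \<in> vars_term (fill K u) \<Longrightarrow> \<sigma> x = \<tau> x) \<Longrightarrow> subst_ctxt K \<sigma> = subst_ctxt K \<tau>"
  by (induction K) (auto intro!: subst_cong)

fun comp_ctxt :: "('f, 's) ctxt \<Rightarrow> ('f, 's) ctxt \<Rightarrow> ('f, 's) ctxt" where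
  "comp_ctxt Hole K' = K'"
| "comp_ctxt (More f ts K us) K' = More f ts (comp_ctxt K K') us"

lemma fill_comp_ctxt [simp]: "fill (comp_ctxt K K') t = fill K (fill K' t)"
  by (induction K) auto

text \<open>The first case is that of parallel occurrences; it yields both ways of closing the square
  after replacing \<open>s\<close> by \<open>s'\<close> and \<open>t\<close> by \<open>t'\<close>.\<close>

lemma fill_eq_fill_cases:
  assumes "fill K1 s = fill K2 t"
  shows "(\<exists>K1' K2'. fill K1 s' = fill K2' t \<and> fill K2 t' = fill K1' s \<and> fill K1' s' = fill K2' t')
    \<or> (\<exists>K. K2 = comp_ctxt K1 K \<and> s = fill K t) \<or> (\<exists>K. K1 = comp_ctxt K2 K \<and> t = fill K s)"
  using assms
proof (induction K1 arbitrary: K2)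
  case Hole
  then show ?case by auto
next
  case (More f ts K us)
  note M = More
  show ?case
  proof (cases K2)
    case Hole
    then show ?thesis using More.prems by auto
  next
    case K2: (More g ts' L us')
    have eq: "g = f" "ts @ fill K s # us = ts' @ fill L t # us'"
      using More.prems K2 by auto
    from eq(2) consider
        (same) "ts = ts'" "fill K s = fill L t" "us = us'"
      | (left) vs where "ts' = ts @ fill K s # vs" "us = vs @ fill L t # us'"
      | (right) vs where "ts = ts' @ fill L t # vs" "us' = vs @ fill K s # us"
      by (fastforce simp: append_eq_append_conv2 append_eq_Cons_conv Cons_eq_append_conv)
    then show ?thesis
    proof cases
      case same
      from More.IH[OF same(2)] show ?thesis
      proof (elim disjE exE conjE)
        fix K1' K2'
        assume "fill K s' = fill K2' t" "fill L t' = fill K1' s" "fill K1' s' = fill K2' t'"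
        then have "fill (More f ts K us) s' = fill (More f ts K2' us) t
          \<and> fill K2 t' = fill (More f ts K1' us) s
          \<and> fill (More f ts K1' us) s' = fill (More f ts K2' us) t'"
          using same eq K2 by simp
        then show ?thesis by blast
      qed (use same eq K2 in auto)
    next
      case left
      have "fill (More f ts K us) s' = fill (More f (ts @ fill K s' # vs) L us') t
        \<and> fill K2 t' = fill (More f ts K (vs @ fill L t' # us')) s
        \<and> fill (More f ts K (vs @ fill L t' # us')) s' = fill (More f (ts @ fill K s' # vs) L us') t'"
        using left eq K2 by simp
      then show ?thesis by blast
    next
      case right
      have "fill (More f ts K us) s' = fill (More f ts' L (vs @ fill K s' # us)) t
        \<and> fill K2 t' = fill (More f (ts' @ fill L t' # vs) K us) s
        \<and> fill (More f (ts' @ fill L t' # vs) K us) s' = fill (More f ts' L (vs @ fill K s' # us)) t'"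
        using right eq K2 by simp
      then show ?thesis by blast
    qed
  qed
qed

text \<open>Separates critical overlaps from variable overlaps: the occurrence of \<open>t\<close>
  starts at a function symbol of \<open>l\<close>, or at or below a variable of \<open>l\<close>. An
  occurrence exactly at a variable belongs to the second case, so \<open>u\<close> in the first
  meets the restriction of (Sup) to non-variable terms.\<close>

lemma subst_eq_fill_cases:
  assumes "l \<cdot> \<sigma> = fill K t"
  shows "(\<exists>K' u. l = fill K' u \<and> (\<nexists>x. u = Var x) \<and> u \<cdot> \<sigma> = t \<and> K = subst_ctxt K' \<sigma>)
    \<or> (\<exists>K' x K''. l = fill K' (Var x) \<and> \<sigma> x = fill K'' t \<and> K = comp_ctxt (subst_ctxt K' \<sigma>) K'')"
  using assms
proof (induction l arbitrary: K)
  case (Var x)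
  then have "Var x = fill Hole (Var x) \<and> \<sigma> x = fill K t \<and> K = comp_ctxt (subst_ctxt Hole \<sigma>) K"
    by simp
  then show ?case by blast
next
  case (Fun f ts)
  show ?case
  proof (cases K)
    case Hole
    then have "Fun f ts = fill Hole (Fun f ts) \<and> (\<nexists>x. Fun f ts = Var x) \<and> Fun f ts \<cdot> \<sigma> = t
      \<and> K = subst_ctxt Hole \<sigma>"
      using Fun.prems by simp
    then show ?thesis by blast
  next
    case (More g ps L qs)
    then have g: "g = f" and "map (\<lambda>t. t \<cdot> \<sigma>) ts = ps @ fill L t # qs"
      using Fun.prems by auto
    then obtain ps' s qs' where ts: "ts = ps' @ s # qs'"
      and ps: "ps = map (\<lambda>t. t \<cdot> \<sigma>) ps'" and s: "s \<cdot> \<sigma> = fill L t"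
      and qs: "qs = map (\<lambda>t. t \<cdot> \<sigma>) qs'"
      by (auto simp: map_eq_append_conv map_eq_Cons_conv)
    have "s \<in> set ts" by (simp add: ts)
    from Fun.IH[OF this s] show ?thesis
    proof (elim disjE exE conjE)
      fix K' u
      assume "s = fill K' u" "\<nexists>x. u = Var x" "u \<cdot> \<sigma> = t" "L = subst_ctxt K' \<sigma>"
      then have "Fun f ts = fill (More f ps' K' qs') u \<and> (\<nexists>x. u = Var x) \<and> u \<cdot> \<sigma> = t
        \<and> K = subst_ctxt (More f ps' K' qs') \<sigma>"
        using More g ts ps qs by simp
      then show ?thesis by blast
    next
      fix K' x K''
      assume "s = fill K' (Var x)" "\<sigma> x = fill K'' t" "L = comp_ctxt (subst_ctxt K' \<sigma>) K''"
      then have "Fun f ts = fill (More f ps' K' qs') (Var x) \<and> \<sigma> x = fill K'' t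
        \<and> K = comp_ctxt (subst_ctxt (More f ps' K' qs') \<sigma>) K''"
        using More g ts ps qs by simp
      then show ?thesis by blast
    qed
  qed
qed

section \<open>Most general unifiers\<close>

lemma size_subst_ge: "x \<in> vars_term t \<Longrightarrow> size (\<sigma> x) \<le> size (t \<cdot> \<sigma>)"
proof (induction t)
  case (Fun f ts)
  then obtain t where t: "t \<in> set ts" "size (\<sigma> x) \<le> size (t \<cdot> \<sigma>)" by auto
  have "size (t \<cdot> \<sigma>) \<le> size_list size (map (\<lambda>t. t \<cdot> \<sigma>) ts)"
    using t by (intro size_list_estimation') auto
  then show ?case using t by simp
qed simp

text \<open>Otherwise \<open>\<tau> x\<close> would be a proper subterm of itself, which sizes
  exclude.\<close>

lemma occurs_check:
  assumes "\<tau> x = t \<cdot> \<tau>" "t \<noteq> Var x"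
  shows "x \<notin> vars_term t"
proof
  assume x: "x \<in> vars_term t"
  then obtain f ts u where t: "t = Fun f ts" "u \<in> set ts" "x \<in> vars_term u"
    using assms by (cases t) auto
  have "size (\<tau> x) \<le> size (u \<cdot> \<tau>)" using t by (simp add: size_subst_ge)
  also have "\<dots> \<le> size_list size (map (\<lambda>t. t \<cdot> \<tau>) ts)"
    using t by (intro size_list_estimation') auto
  also have "\<dots> < size (\<tau> x)" using assms t by simp
  finally show False by simp
qed

definition unifies :: "('f, 's) subst \<Rightarrow> (('f, 's) trm \<times> ('f, 's) trm) list \<Rightarrow> bool" where
  "unifies \<tau> E \<longleftrightarrow> (\<forall>(s, t) \<in> set E. s \<cdot> \<tau> = t \<cdot> \<tau>)"

definition same_sorts :: "('f, 's) signature \<Rightarrow> (('f, 's) trm \<times> ('f, 's) trm) list \<Rightarrow> bool" where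
  "same_sorts sig E \<longleftrightarrow> (\<forall>(s, t) \<in> set E. \<exists>a. has_sort sig s a \<and> has_sort sig t a)"

text \<open>The idempotent form of most generality: a unifier \<open>\<tau>\<close> factors through
  \<open>\<sigma>\<close> with \<open>\<tau>\<close> itself as second factor. So no mediating
  substitution has to be constructed when variable eliminations are composed.\<close>

definition idem_mgu ::
  "('f, 's) signature \<Rightarrow> ('f, 's) subst \<Rightarrow> (('f, 's) trm \<times> ('f, 's) trm) list \<Rightarrow> bool" where
  "idem_mgu sig \<sigma> E \<longleftrightarrow> wt_subst sig \<sigma> \<and> unifies \<sigma> E \<and>
     (\<forall>\<tau>. wt_subst sig \<tau> \<longrightarrow> unifies \<tau> E \<longrightarrow> (\<forall>x. \<tau> x = \<sigma> x \<cdot> \<tau>))"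

definition subst_eqs ::
  "(('f, 's) trm \<times> ('f, 's) trm) list \<Rightarrow> ('f, 's) subst \<Rightarrow> (('f, 's) trm \<times> ('f, 's) trm) list" where
  "subst_eqs E \<sigma> = map (\<lambda>(s, t). (s \<cdot> \<sigma>, t \<cdot> \<sigma>)) E"

lemma subst_upd_absorb: "\<tau> x = t \<cdot> \<tau> \<Longrightarrow> s \<cdot> Var(x := t) \<cdot> \<tau> = s \<cdot> \<tau>"
  by (auto simp: subst_subst intro!: subst_cong)

lemma idem_mgu_eliminate:
  assumes x: "x \<notin> vars_term t" "has_sort sig t (snd x)"
    and \<sigma>: "idem_mgu sig \<sigma> (subst_eqs E (Var(x := t)))"
  shows "idem_mgu sig (\<lambda>y. (Var(x := t)) y \<cdot> \<sigma>) ((Var x, t) # E)"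
proof -
  let ?\<sigma>1 = "Var(x := t)"
  let ?\<sigma> = "\<lambda>y. ?\<sigma>1 y \<cdot> \<sigma>"
  have wt1: "wt_subst sig ?\<sigma>1"
    using x(2) by (auto simp: wt_subst_def has_sort_Var)
  have "wt_subst sig ?\<sigma>"
    using \<sigma> wt_subst_comp[OF wt1] by (auto simp: idem_mgu_def)
  moreover have "t \<cdot> ?\<sigma> = t \<cdot> \<sigma>"
    using x(1) by (intro subst_cong) auto
  then have "unifies ?\<sigma> ((Var x, t) # E)"
    using \<sigma> by (auto simp: idem_mgu_def unifies_def subst_eqs_def subst_subst)
  moreover have "\<tau> y = ?\<sigma> y \<cdot> \<tau>"
    if \<tau>: "wt_subst sig \<tau>" "unifies \<tau> ((Var x, t) # E)" for \<tau> y
  proof -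
    have x\<tau>: "\<tau> x = t \<cdot> \<tau>" using \<tau>(2) by (auto simp: unifies_def)
    have "unifies \<tau> (subst_eqs E ?\<sigma>1)"
      using \<tau>(2) by (auto simp: unifies_def subst_eqs_def subst_upd_absorb[OF x\<tau>])
    then have idem: "\<tau> z = \<sigma> z \<cdot> \<tau>" for z
      using \<sigma> \<tau>(1) by (simp add: idem_mgu_def del: split_paired_All)
    have "?\<sigma>1 y \<cdot> \<sigma> \<cdot> \<tau> = ?\<sigma>1 y \<cdot> \<tau>"
      unfolding subst_subst by (intro subst_cong) (simp add: idem[symmetric])
    then show ?thesis using x\<tau> by auto
  qed
  ultimately show ?thesis by (auto simp: idem_mgu_def)
qed

lemma idem_mgu_swap: "idem_mgu sig \<sigma> ((s, t) # E) = idem_mgu sig \<sigma> ((t, s) # E)"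
  by (auto simp: idem_mgu_def unifies_def)

lemma idem_mgu_decompose:
  assumes "length ss = length ts"
  shows "idem_mgu sig \<sigma> ((Fun f ss, Fun f ts) # E) = idem_mgu sig \<sigma> (zip ss ts @ E)"
proof -
  have "unifies \<tau> ((Fun f ss, Fun f ts) # E) = unifies \<tau> (zip ss ts @ E)" for \<tau>
    using assms by (auto simp: unifies_def list_eq_iff_nth_eq set_zip)
  then show ?thesis by (simp add: idem_mgu_def)
qed

text \<open>The sizes of the instances under the given unifier \<open>\<tau>\<close> bound the run of the unification
  algorithm: eliminating a variable does not change them.\<close>

lemma idem_mgu_exists:
  assumes "wt_subst sig \<tau>"
  shows "unifies \<tau> E \<Longrightarrow> same_sorts sig E \<Longrightarrow> \<exists>\<sigma>. idem_mgu sig \<sigma> E"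
\<comment> \<open>The \<open>Suc\<close> makes dropping an equation a strict decrease whatever its
  size. It also matches \<open>size_list\<close>, which adds one per list entry, so that decomposing
  a pair of function terms decreases the sum.\<close>
proof (induction E rule: measure_induct_rule[where f = "\<lambda>E. \<Sum>(s, t)\<leftarrow>E. Suc (size (s \<cdot> \<tau>))"])
  case (less E)
  show ?case
  proof (cases E)
    case Nil
    then have "idem_mgu sig Var E"
      by (auto simp: idem_mgu_def wt_subst_Var unifies_def)
    then show ?thesis by blast
  next
    case (Cons e E')
    obtain s t where e: "e = (s, t)" by fastforce
    have u: "s \<cdot> \<tau> = t \<cdot> \<tau>" "unifies \<tau> E'" and so: "same_sorts sig E'"
      using less.prems Cons e by (auto simp: unifies_def same_sorts_def)
    obtain a where a: "has_sort sig s a" "has_sort sig t a"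
      using less.prems Cons e by (auto simp: same_sorts_def)
    have elim: "\<exists>\<sigma>. idem_mgu sig \<sigma> ((Var x, v) # E')"
      if x: "\<tau> x = v \<cdot> \<tau>" "v \<noteq> Var x" "has_sort sig v (snd x)" for x v
    proof -
      have wt1: "wt_subst sig (Var(x := v))"
        using x(3) by (auto simp: wt_subst_def has_sort_Var)
      have "(\<Sum>(s, t)\<leftarrow>subst_eqs E' (Var(x := v)). Suc (size (s \<cdot> \<tau>)))
          = (\<Sum>(s, t)\<leftarrow>E'. Suc (size (s \<cdot> \<tau>)))"
        unfolding subst_eqs_def map_map
        by (intro arg_cong[of _ _ sum_list] map_cong)
          (auto simp: subst_upd_absorb[OF x(1)])
      moreover have "unifies \<tau> (subst_eqs E' (Var(x := v)))"
        using u(2) by (auto simp: unifies_def subst_eqs_def subst_upd_absorb[OF x(1)])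
      moreover have "same_sorts sig (subst_eqs E' (Var(x := v)))"
        using so by (fastforce simp: same_sorts_def subst_eqs_def intro: has_sort_subst[OF wt1])
      ultimately obtain \<sigma> where "idem_mgu sig \<sigma> (subst_eqs E' (Var(x := v)))"
        using less.IH[of "subst_eqs E' (Var(x := v))"] Cons e by auto
      from idem_mgu_eliminate[OF occurs_check[OF x(1,2)] x(3) this] show ?thesis by blast
    qed
    show ?thesis
    proof (cases "s = t")
      case True
      have "(\<Sum>(s, t)\<leftarrow>E'. Suc (size (s \<cdot> \<tau>))) < (\<Sum>(s, t)\<leftarrow>E. Suc (size (s \<cdot> \<tau>)))"
        using Cons e by simp
      then obtain \<sigma> where "idem_mgu sig \<sigma> E'" using less.IH u so by blast
      then have "idem_mgu sig \<sigma> E"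
        using Cons e True by (auto simp: idem_mgu_def unifies_def)
      then show ?thesis by blast
    next
      case ne: False
      show ?thesis
      proof (cases s)
        case (Var x)
        then show ?thesis using elim[of x t] ne u(1) a Cons e by (auto simp: has_sort_Var)
      next
        case s: (Fun f ss)
        show ?thesis
        proof (cases t)
          case (Var x)
          have "\<exists>\<sigma>. idem_mgu sig \<sigma> ((Var x, s) # E')"
            using elim[of x s] ne u(1) a Var by (auto simp: has_sort_Var)
          then have "\<exists>\<sigma>. idem_mgu sig \<sigma> ((s, Var x) # E')"
            using idem_mgu_swap by blast
          then show ?thesis using Cons e Var by simp
        next
          case t: (Fun g ts)
          have gf: "g = f" and m: "map (\<lambda>t. t \<cdot> \<tau>) ss = map (\<lambda>t. t \<cdot> \<tau>) ts"
            using u(1) s t by auto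
          have len: "length ss = length ts" using m map_eq_imp_length_eq by blast
          have "(\<Sum>(s, t)\<leftarrow>zip ss ts. Suc (size (s \<cdot> \<tau>))) = (\<Sum>s\<leftarrow>map fst (zip ss ts). Suc (size (s \<cdot> \<tau>)))"
            by (simp add: case_prod_unfold o_def)
          also have "\<dots> = size_list size (map (\<lambda>t. t \<cdot> \<tau>) ss)"
            using len by (simp add: size_list_conv_sum_list o_def sum_list_Suc)
          finally have "(\<Sum>(s, t)\<leftarrow>zip ss ts @ E'. Suc (size (s \<cdot> \<tau>))) < (\<Sum>(s, t)\<leftarrow>E. Suc (size (s \<cdot> \<tau>)))"
            using Cons e s by simp
          moreover have "unifies \<tau> (zip ss ts @ E')"
            using u(2) m by (auto simp: unifies_def set_zip list_eq_iff_nth_eq)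
          moreover have "same_sorts sig (zip ss ts @ E')"
            using so a s t gf
            by (fastforce simp: same_sorts_def set_zip has_sort_Fun list_all2_conv_all_nth)
          ultimately obtain \<sigma> where "idem_mgu sig \<sigma> (zip ss ts @ E')"
            using less.IH by blast
          then show ?thesis using idem_mgu_decompose[OF len] Cons e s t gf by blast
        qed
      qed
    qed
  qed
qed

lemma is_mgu_exists:
  assumes "is_unifier sig \<tau> s t" "has_sort sig s a" "has_sort sig t a"
  shows "\<exists>\<sigma>. is_mgu sig \<sigma> s t"
proof -
  obtain \<sigma> where "idem_mgu sig \<sigma> [(s, t)]"
    using idem_mgu_exists[of sig \<tau> "[(s, t)]"] assms
    by (auto simp: is_unifier_def unifies_def same_sorts_def)
  then have "is_mgu sig \<sigma> s t"
    unfolding is_mgu_def is_unifier_def idem_mgu_def unifies_def by auto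
  then show ?thesis by blast
qed

lemma renaming_apart:
  fixes V W :: "'s var set"
  assumes "finite V" "finite W"
  shows "\<exists>\<pi> :: 's var \<Rightarrow> 's var. bij \<pi> \<and> (\<forall>x. snd (\<pi> x) = snd x) \<and> V \<inter> \<pi> ` W = {}"
proof -
  have "finite (fst ` (V \<union> W))" using assms by simp
  then obtain n where n: "\<forall>i \<in> fst ` (V \<union> W). i < n"
    using finite_nat_set_iff_bounded by blast
  \<comment> \<open>Within each sort the indices below \<open>n\<close> change places with the block
    from \<open>n\<close> to \<open>2 * n - 1\<close>. The map is an involution, which gives
    bijectivity for free, and it sends \<open>W\<close> to indices at or above \<open>n\<close>,
    beyond those of \<open>V\<close>.\<close>
  define \<pi> :: "'s var \<Rightarrow> 's var" where
    "\<pi> = (\<lambda>(i, s). (if i < n then i + n else if i < 2 * n then i - n else i, s))"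
  have "\<pi> (\<pi> x) = x" for x by (cases x) (auto simp: \<pi>_def)
  then have "bij \<pi>" by (metis involuntory_imp_bij)
  moreover have "\<forall>x. snd (\<pi> x) = snd x" by (auto simp: \<pi>_def)
  moreover have "V \<inter> \<pi> ` W = {}"
  proof -
    have "\<pi> x \<notin> V" if "x \<in> W" for x
    proof -
      have "fst x < n" using n that by blast
      then have "\<not> fst (\<pi> x) < n" by (cases x) (simp add: \<pi>_def)
      then show ?thesis using n by blast
    qed
    then show ?thesis by blast
  qed
  ultimately show ?thesis by blast
qed

section \<open>Confluence modulo critical pairs\<close>

text \<open>The Winkler--Buchberger criterion: connectedness of each peak below its top replaces the
  joinability in Newman's lemma.\<close>

lemma confluent_if_connected_below:
  assumes wf: "wfp lt"
    and dec: "\<And>x y. D x y \<Longrightarrow> lt y x"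
    and conn: "\<And>b x y. D b x \<Longrightarrow> D b y \<Longrightarrow>
      (\<lambda>u v. (D u v \<or> D v u) \<and> lt u b \<and> lt v b)\<^sup>*\<^sup>* x y"
  shows "D\<^sup>*\<^sup>* b x \<Longrightarrow> D\<^sup>*\<^sup>* b y \<Longrightarrow> \<exists>z. D\<^sup>*\<^sup>* x z \<and> D\<^sup>*\<^sup>* y z"
  using wf
proof (induction b arbitrary: x y rule: wfp_induct_rule)
  case (less b)
  show ?case
  proof (cases "b = x \<or> b = y")
    case True
    then show ?thesis using less.prems by blast
  next
    case False
    then obtain x1 y1 where x1: "D b x1" "D\<^sup>*\<^sup>* x1 x" and y1: "D b y1" "D\<^sup>*\<^sup>* y1 y"
      using less.prems by (metis converse_rtranclpE)
    \<comment> \<open>The connecting conversion is walked from \<open>x1\<close> to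
      \<open>y1\<close> while keeping a valley between \<open>x1\<close> and the current point. A
      backward step prolongs the valley; a forward step creates a peak at a point below
      \<open>b\<close>, which the induction hypothesis resolves.\<close>
    have "\<exists>z. D\<^sup>*\<^sup>* x1 z \<and> D\<^sup>*\<^sup>* y1 z"
      using conn[OF x1(1) y1(1)]
    proof (induction rule: rtranclp_induct)
      case (step u v)
      then obtain z where z: "D\<^sup>*\<^sup>* x1 z" "D\<^sup>*\<^sup>* u z" by blast
      show ?case
      proof (cases "D u v")
        case True
        then obtain z' where "D\<^sup>*\<^sup>* z z'" "D\<^sup>*\<^sup>* v z'"
          using less.IH[of u z v] step.hyps(2) z(2) by blast
        then show ?thesis using z(1) by (meson rtranclp_trans)
      next
        case False
        then show ?thesis using step.hyps(2) z by (meson converse_rtranclp_into_rtranclp)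
      qed
    qed blast
    then obtain z where z: "D\<^sup>*\<^sup>* x1 z" "D\<^sup>*\<^sup>* y1 z" by blast
    obtain p where p: "D\<^sup>*\<^sup>* x p" "D\<^sup>*\<^sup>* z p"
      using less.IH[OF dec[OF x1(1)] x1(2) z(1)] by blast
    have "D\<^sup>*\<^sup>* y1 p" using z(2) p(2) by (rule rtranclp_trans)
    then obtain q where "D\<^sup>*\<^sup>* y q" "D\<^sup>*\<^sup>* p q"
      using less.IH[OF dec[OF y1(1)] y1(2)] by blast
    then show ?thesis using p(1) by (meson rtranclp_trans)
  qed
qed

text \<open>\<open>gr\<close> is monotone in contexts but not assumed stable under substitutions.
  This is why \<open>critical_pair\<close> asks for orientation of the overlapping instances, and
  why it leaves the orientation of the bridging equation open: totality decides it
  afterwards.\<close>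

locale saturated_equations =
  fixes sig :: "('f, 's) signature"
    and S :: "(('f, 's) trm \<times> ('f, 's) trm) set"
    and gr :: "('f, 's) trm \<Rightarrow> ('f, 's) trm \<Rightarrow> bool"
  assumes S_sort: "(l, r) \<in> S \<Longrightarrow> \<exists>a. has_sort sig l a \<and> has_sort sig r a"
    and S_sym: "(l, r) \<in> S \<Longrightarrow> (r, l) \<in> S"
    and gr_trans: "transp_on (wt_terms sig) gr"
    and gr_wf: "wfp_on (wt_terms sig) (\<lambda>s t. gr t s)"
    and gr_total: "totalp_on (wt_terms sig) gr"
    and gr_fill: "fill K s \<in> wt_terms sig \<Longrightarrow> fill K t \<in> wt_terms sig \<Longrightarrow> gr s t \<Longrightarrow>
      gr (fill K s) (fill K t)"
    and critical_pair: "(fill K u, t) \<in> S \<Longrightarrow> (l, r) \<in> S \<Longrightarrow> \<nexists>x. u = Var x \<Longrightarrow>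
      wt_subst sig \<sigma> \<Longrightarrow> wt_subst sig \<theta> \<Longrightarrow> u \<cdot> \<sigma> = l \<cdot> \<theta> \<Longrightarrow>
      gr (l \<cdot> \<theta>) (r \<cdot> \<theta>) \<Longrightarrow> gr (fill K u \<cdot> \<sigma>) (t \<cdot> \<sigma>) \<Longrightarrow>
      \<exists>p q \<delta>. (p, q) \<in> S \<and> wt_subst sig \<delta> \<and>
        p \<cdot> \<delta> = fill (subst_ctxt K \<sigma>) (r \<cdot> \<theta>) \<and> q \<cdot> \<delta> = t \<cdot> \<sigma>"
begin

inductive step :: "('f, 's) trm \<Rightarrow> ('f, 's) trm \<Rightarrow> bool" where
  "(l, r) \<in> S \<Longrightarrow> wt_subst sig \<sigma> \<Longrightarrow> step (fill K (l \<cdot> \<sigma>)) (fill K (r \<cdot> \<sigma>))"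

text \<open>Orientation is a property of the instance. One equation may act from left to right under
  one substitution and from right to left under another.\<close>

inductive down :: "('f, 's) trm \<Rightarrow> ('f, 's) trm \<Rightarrow> bool" where
  "(l, r) \<in> S \<Longrightarrow> wt_subst sig \<sigma> \<Longrightarrow> gr (l \<cdot> \<sigma>) (r \<cdot> \<sigma>) \<Longrightarrow>
    down (fill K (l \<cdot> \<sigma>)) (fill K (r \<cdot> \<sigma>))"

text \<open>Well-sortedness is built in to get well-foundedness on all raw terms. The common sort
  makes the relation closed under contexts as soon as the larger term is well-sorted in its
  context.\<close>

definition lt :: "('f, 's) trm \<Rightarrow> ('f, 's) trm \<Rightarrow> bool" where
  "lt s t \<longleftrightarrow> gr t s \<and> (\<exists>a. has_sort sig s a \<and> has_sort sig t a)"

lemma lt_trans: "lt s t \<Longrightarrow> lt t u \<Longrightarrow> lt s u"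
  unfolding lt_def using transp_onD[OF gr_trans, of u t s] has_sort_unique[of sig t]
  unfolding wt_terms_def by blast

lemma lt_wf: "wfp lt"
proof (rule wfp_subset[OF iffD1[OF wfp_on_iff_wfp gr_wf]])
  show "lt \<le> (\<lambda>s t. gr t s \<and> s \<in> wt_terms sig \<and> t \<in> wt_terms sig)"
    by (auto simp: lt_def wt_terms_def)
qed

lemma lt_fill:
  assumes "lt s t" "has_sort sig (fill K t) a"
  shows "lt (fill K s) (fill K t)"
proof -
  obtain b where "has_sort sig s b" "has_sort sig t b" using assms(1) by (auto simp: lt_def)
  then have "has_sort sig (fill K s) a"
    by (rule has_sort_fill_replace[OF assms(2), rotated])
  then show ?thesis using assms gr_fill by (auto simp: lt_def wt_terms_def)
qed

lemma instance_sort: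
  "(l, r) \<in> S \<Longrightarrow> wt_subst sig \<sigma> \<Longrightarrow> \<exists>a. has_sort sig (l \<cdot> \<sigma>) a \<and> has_sort sig (r \<cdot> \<sigma>) a"
  using S_sort[of l r] has_sort_subst[of sig \<sigma>] by blast

lemma down_lt:
  assumes "down s t" "has_sort sig s a"
  shows "lt t s"
  using assms
proof (cases rule: down.cases)
  case (1 l r \<sigma> K)
  then have "lt (r \<cdot> \<sigma>) (l \<cdot> \<sigma>)" using instance_sort unfolding lt_def by blast
  then show ?thesis using lt_fill assms(2) 1 by blast
qed

lemma down_fill: "down s t \<Longrightarrow> down (fill K s) (fill K t)"
  by (metis down.cases down.intros fill_comp_ctxt)

lemma downs_fill: "down\<^sup>*\<^sup>* s t \<Longrightarrow> down\<^sup>*\<^sup>* (fill K s) (fill K t)"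
  by (induction rule: rtranclp_induct) (auto intro: rtranclp.rtrancl_into_rtrancl down_fill)

text \<open>The prefix \<open>ps\<close> collects the arguments that are already rewritten while the
  induction moves along the list.\<close>

lemma downs_Fun:
  "list_all2 down\<^sup>*\<^sup>* ts us \<Longrightarrow> down\<^sup>*\<^sup>* (Fun f (ps @ ts)) (Fun f (ps @ us))"
proof (induction arbitrary: ps rule: list_all2_induct)
  case (Cons t ts u us)
  have "down\<^sup>*\<^sup>* (Fun f (ps @ t # ts)) (Fun f (ps @ u # ts))"
    using downs_fill[OF Cons.hyps(1), of "More f ps Hole ts"] by simp
  also have "down\<^sup>*\<^sup>* (Fun f (ps @ u # ts)) (Fun f (ps @ u # us))"
    using Cons.IH[of "ps @ [u]"] by simp
  finally show ?case .
qed simp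

text \<open>All copies of \<open>x\<close> are rewritten one after another. After a variable overlap
  this brings the copies that the inner step missed into line.\<close>

lemma downs_subst_upd:
  assumes "down (\<sigma> x) v"
  shows "down\<^sup>*\<^sup>* (t \<cdot> \<sigma>) (t \<cdot> \<sigma>(x := v))"
proof (induction t)
  case (Fun f ts)
  then show ?case
    using downs_Fun[of "map (\<lambda>t. t \<cdot> \<sigma>) ts" "map (\<lambda>t. t \<cdot> \<sigma>(x := v)) ts" f "[]"]
    by (simp add: list_all2_conv_all_nth del: fun_upd_apply)
qed (use assms in auto)

lemma downs_subst_ctxt_upd:
  assumes "down (\<sigma> x) v"
  shows "down\<^sup>*\<^sup>* (fill (subst_ctxt K \<sigma>) w) (fill (subst_ctxt K (\<sigma>(x := v))) w)"
proof (induction K)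
  case (More f ts K us)
  have "list_all2 down\<^sup>*\<^sup>* (map (\<lambda>t. t \<cdot> \<sigma>) ts @ fill (subst_ctxt K \<sigma>) w # map (\<lambda>t. t \<cdot> \<sigma>) us)
      (map (\<lambda>t. t \<cdot> \<sigma>(x := v)) ts @ fill (subst_ctxt K (\<sigma>(x := v))) w #
        map (\<lambda>t. t \<cdot> \<sigma>(x := v)) us)"
    using More.IH downs_subst_upd[of \<sigma> x v, OF assms]
    by (intro list_all2_appendI list.rel_intros)
      (auto simp: list_all2_conv_all_nth simp del: fun_upd_apply)
  from downs_Fun[OF this, of f "[]"] show ?case by (simp del: fun_upd_apply)
qed simp

abbreviation conv_below :: "('f, 's) trm \<Rightarrow> ('f, 's) trm \<Rightarrow> ('f, 's) trm \<Rightarrow> bool" where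
  "conv_below b \<equiv> (\<lambda>u v. (down u v \<or> down v u) \<and> lt u b \<and> lt v b)\<^sup>*\<^sup>*"

lemma conv_below_sym: "conv_below b s t \<Longrightarrow> conv_below b t s"
  by (rule sympD[OF symp_rtranclp]) (auto simp: symp_def)

lemma conv_below_fill:
  assumes "conv_below b s t" "has_sort sig (fill K b) a"
  shows "conv_below (fill K b) (fill K s) (fill K t)"
  using assms(1)
proof (induction rule: rtranclp_induct)
  case (step u v)
  show ?case
    by (rule rtranclp.rtrancl_into_rtrancl[OF step.IH])
      (use step.hyps(2) down_fill lt_fill[OF _ assms(2)] in blast)
qed simp

lemma downs_below:
  assumes "down\<^sup>*\<^sup>* s t" "lt s b"
  shows "conv_below b s t \<and> lt t b"
  using assms
proof (induction rule: rtranclp_induct)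
  case (step u v)
  then have u: "conv_below b s u" "lt u b" by auto
  then have "lt v u" using down_lt step.hyps(2) by (auto simp: lt_def)
  then have "lt v b" using u lt_trans by blast
  moreover have "conv_below b s v"
    by (rule rtranclp.rtrancl_into_rtrancl[OF u(1)]) (use u(2) calculation step.hyps(2) in blast)
  ultimately show ?case by blast
qed simp

lemma step_cases: "step s t \<Longrightarrow> s = t \<or> down s t \<or> down t s"
proof (elim step.cases)
  fix l r \<sigma> K
  assume *: "s = fill K (l \<cdot> \<sigma>)" "t = fill K (r \<cdot> \<sigma>)" "(l, r) \<in> S" "wt_subst sig \<sigma>"
  have "l \<cdot> \<sigma> = r \<cdot> \<sigma> \<or> gr (l \<cdot> \<sigma>) (r \<cdot> \<sigma>) \<or> gr (r \<cdot> \<sigma>) (l \<cdot> \<sigma>)"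
    using totalp_onD[OF gr_total, of "l \<cdot> \<sigma>" "r \<cdot> \<sigma>"] instance_sort[OF *(3,4)]
    by (auto simp: wt_terms_def)
  then show ?thesis
    using down.intros[OF *(3,4), of K] down.intros[OF S_sym[OF *(3)] *(4), of K] * by metis
qed

lemma instance_conv_below:
  assumes "(l, r) \<in> S" "wt_subst sig \<sigma>" "lt (l \<cdot> \<sigma>) b" "lt (r \<cdot> \<sigma>) b"
  shows "conv_below b (l \<cdot> \<sigma>) (r \<cdot> \<sigma>)"
proof -
  have "l \<cdot> \<sigma> = r \<cdot> \<sigma> \<or> down (l \<cdot> \<sigma>) (r \<cdot> \<sigma>) \<or> down (r \<cdot> \<sigma>) (l \<cdot> \<sigma>)"
    using step_cases[OF step.intros[OF assms(1,2), of Hole]] by simp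
  then show ?thesis using assms by (metis (mono_tags, lifting) r_into_rtranclp rtranclp.rtrancl_refl)
qed

text \<open>In a critical overlap both reducts are the sides of one instance of an equation in
  \<open>S\<close>. In a variable overlap the inner step is repeated on every copy of the variable,
  which leads both reducts to sides of the instance of the outer equation under the rewritten
  substitution. All terms met lie below the peak.\<close>

lemma overlap_conv_below:
  assumes lr: "(l, r) \<in> S" "wt_subst sig \<sigma>" "gr (l \<cdot> \<sigma>) (r \<cdot> \<sigma>)"
    and pq: "(p, q) \<in> S" "wt_subst sig \<theta>" "gr (p \<cdot> \<theta>) (q \<cdot> \<theta>)"
    and overlap: "l \<cdot> \<sigma> = fill K (p \<cdot> \<theta>)"
  shows "conv_below (l \<cdot> \<sigma>) (r \<cdot> \<sigma>) (fill K (q \<cdot> \<theta>))"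
proof -
  obtain a where a: "has_sort sig (l \<cdot> \<sigma>) a" using instance_sort[OF lr(1,2)] by blast
  have r_lt: "lt (r \<cdot> \<sigma>) (l \<cdot> \<sigma>)"
    using down_lt[OF down.intros[OF lr, of Hole]] a by simp
  have q_lt: "lt (fill K (q \<cdot> \<theta>)) (l \<cdot> \<sigma>)"
    using down_lt[OF down.intros[OF pq, of K]] a overlap by simp
  from subst_eq_fill_cases[OF overlap] show ?thesis
  proof (elim disjE exE conjE)
    fix K' u
    assume l: "l = fill K' u" and u: "\<nexists>x. u = Var x" "u \<cdot> \<sigma> = p \<cdot> \<theta>"
      and K: "K = subst_ctxt K' \<sigma>"
    obtain p' q' \<delta> where "(p', q') \<in> S" "wt_subst sig \<delta>"
      "p' \<cdot> \<delta> = fill K (q \<cdot> \<theta>)" "q' \<cdot> \<delta> = r \<cdot> \<sigma>"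
      using critical_pair[of K' u r p q \<sigma> \<theta>] lr pq u unfolding l K by blast
    then show ?thesis
      using instance_conv_below[of q' p' \<delta> "l \<cdot> \<sigma>"] S_sym r_lt q_lt by metis
  next
    fix K' x K''
    assume l: "l = fill K' (Var x)" and x: "\<sigma> x = fill K'' (p \<cdot> \<theta>)"
      and K: "K = comp_ctxt (subst_ctxt K' \<sigma>) K''"
    let ?v = "fill K'' (q \<cdot> \<theta>)"
    let ?\<sigma> = "\<sigma>(x := ?v)"
    have d: "down (\<sigma> x) ?v" using down.intros[OF pq] x by metis
    have wt: "wt_subst sig ?\<sigma>"
    proof -
      have "has_sort sig ?v (snd x)"
        using has_sort_wt_subst[OF lr(2), of x] x instance_sort[OF pq(1,2)] has_sort_fill_replace
        by metis
      then show ?thesis using lr(2) by (simp add: wt_subst_def del: split_paired_All)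
    qed
    have r: "conv_below (l \<cdot> \<sigma>) (r \<cdot> \<sigma>) (r \<cdot> ?\<sigma>)" "lt (r \<cdot> ?\<sigma>) (l \<cdot> \<sigma>)"
      using downs_below[OF downs_subst_upd[of \<sigma> x ?v, OF d] r_lt] by auto
    have "fill K (q \<cdot> \<theta>) = fill (subst_ctxt K' \<sigma>) ?v" by (simp add: K)
    moreover have "l \<cdot> ?\<sigma> = fill (subst_ctxt K' ?\<sigma>) ?v" by (simp add: l subst_fill)
    ultimately have "down\<^sup>*\<^sup>* (fill K (q \<cdot> \<theta>)) (l \<cdot> ?\<sigma>)"
      using downs_subst_ctxt_upd[of \<sigma> x ?v K' ?v, OF d] by simp
    then have q: "conv_below (l \<cdot> \<sigma>) (fill K (q \<cdot> \<theta>)) (l \<cdot> ?\<sigma>)" "lt (l \<cdot> ?\<sigma>) (l \<cdot> \<sigma>)"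
      using downs_below[OF _ q_lt] by auto
    \<comment> \<open>The new instance of the equation may be oriented opposite to the old one; as a
      conversion step it serves either way.\<close>
    have "conv_below (l \<cdot> \<sigma>) (r \<cdot> ?\<sigma>) (l \<cdot> ?\<sigma>)"
      using instance_conv_below[OF S_sym[OF lr(1)] wt] r(2) q(2) by blast
    then show ?thesis using r(1) conv_below_sym[OF q(1)] by (meson rtranclp_trans)
  qed
qed

lemma peak_conv_below:
  assumes "down b x" "down b y" "has_sort sig b a"
  shows "conv_below b x y"
proof -
  obtain l1 r1 \<sigma>1 K1 where 1: "(l1, r1) \<in> S" "wt_subst sig \<sigma>1" "gr (l1 \<cdot> \<sigma>1) (r1 \<cdot> \<sigma>1)"
    and b1: "b = fill K1 (l1 \<cdot> \<sigma>1)" and x: "x = fill K1 (r1 \<cdot> \<sigma>1)"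
    using assms(1) by (auto elim: down.cases)
  obtain l2 r2 \<sigma>2 K2 where 2: "(l2, r2) \<in> S" "wt_subst sig \<sigma>2" "gr (l2 \<cdot> \<sigma>2) (r2 \<cdot> \<sigma>2)"
    and b2: "b = fill K2 (l2 \<cdot> \<sigma>2)" and y: "y = fill K2 (r2 \<cdot> \<sigma>2)"
    using assms(2) by (auto elim: down.cases)
  from fill_eq_fill_cases[OF b1[symmetric, THEN trans, OF b2], of "r1 \<cdot> \<sigma>1" "r2 \<cdot> \<sigma>2"]
  show ?thesis
  proof (elim disjE exE conjE)
    fix K1' K2'
    assume *: "fill K1 (r1 \<cdot> \<sigma>1) = fill K2' (l2 \<cdot> \<sigma>2)" "fill K2 (r2 \<cdot> \<sigma>2) = fill K1' (l1 \<cdot> \<sigma>1)"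
      "fill K1' (r1 \<cdot> \<sigma>1) = fill K2' (r2 \<cdot> \<sigma>2)"
    have "down x (fill K2' (r2 \<cdot> \<sigma>2))" using down.intros[OF 2] * x by metis
    then have "conv_below b x (fill K2' (r2 \<cdot> \<sigma>2))"
      using downs_below down_lt[OF assms(1,3)] by blast
    moreover have "down y (fill K2' (r2 \<cdot> \<sigma>2))" using down.intros[OF 1] * y by metis
    then have "conv_below b y (fill K2' (r2 \<cdot> \<sigma>2))"
      using downs_below down_lt[OF assms(2,3)] by blast
    ultimately show ?thesis using conv_below_sym by (meson rtranclp_trans)
  next
    fix K
    assume "K2 = comp_ctxt K1 K" "l1 \<cdot> \<sigma>1 = fill K (l2 \<cdot> \<sigma>2)"
    then show ?thesis
      using conv_below_fill[OF overlap_conv_below[OF 1 2], of K K1] b1 x y assms(3) by simp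
  next
    fix K
    assume "K1 = comp_ctxt K2 K" "l2 \<cdot> \<sigma>2 = fill K (l1 \<cdot> \<sigma>1)"
    then show ?thesis
      using conv_below_fill[OF overlap_conv_below[OF 2 1], of K K2] b2 x y assms(3)
      by (intro conv_below_sym[of b y x]) simp
  qed
qed

lemma step_sort: "step s t \<Longrightarrow> has_sort sig s a \<Longrightarrow> has_sort sig t a"
  by (elim step.cases) (metis instance_sort has_sort_fill_replace)

lemma steps_sort: "step\<^sup>*\<^sup>* s t \<Longrightarrow> has_sort sig s a \<Longrightarrow> has_sort sig t a"
  by (induction rule: rtranclp_induct) (auto intro: step_sort)

theorem church_rosser:
  assumes "step\<^sup>*\<^sup>* s t" "has_sort sig s a"
  shows "\<exists>u. down\<^sup>*\<^sup>* s u \<and> down\<^sup>*\<^sup>* t u"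
proof -
  \<comment> \<open>\<open>down\<close> also acts inside ill-sorted terms, where nothing ensures a
    decrease. With a well-sorted source every step decreases in \<open>lt\<close>.\<close>
  define D where "D = (\<lambda>s t. down s t \<and> s \<in> wt_terms sig)"
  have dec: "D x y \<Longrightarrow> lt y x" for x y using down_lt by (auto simp: D_def wt_terms_def)
  have "conv_below b x y \<Longrightarrow> (\<lambda>u v. (D u v \<or> D v u) \<and> lt u b \<and> lt v b)\<^sup>*\<^sup>* x y" for b x y
    by (erule rtranclp_mono[THEN predicate2D, rotated]) (auto simp: D_def lt_def wt_terms_def)
  then have conn: "D b x \<Longrightarrow> D b y \<Longrightarrow> (\<lambda>u v. (D u v \<or> D v u) \<and> lt u b \<and> lt v b)\<^sup>*\<^sup>* x y" for b x y
    using peak_conv_below by (auto simp: D_def wt_terms_def)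
  have "\<exists>u. D\<^sup>*\<^sup>* s u \<and> D\<^sup>*\<^sup>* t u"
    using assms(1)
  proof (induction rule: rtranclp_induct)
    case (step t t')
    then obtain u where u: "D\<^sup>*\<^sup>* s u" "D\<^sup>*\<^sup>* t u" by blast
    have "t \<in> wt_terms sig" "t' \<in> wt_terms sig"
      using steps_sort[OF step.hyps(1) assms(2)] step_sort[OF step.hyps(2)] by (auto simp: wt_terms_def)
    with step_cases[OF step.hyps(2)] consider "t = t'" | "D t t'" | "D t' t"
      by (auto simp: D_def)
    then show ?case
    proof cases
      case 2
      then obtain u' where "D\<^sup>*\<^sup>* u u'" "D\<^sup>*\<^sup>* t' u'"
        using confluent_if_connected_below[OF lt_wf dec conn u(2)] by blast
      then show ?thesis using u(1) by (meson rtranclp_trans)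
    qed (use u in \<open>auto intro: converse_rtranclp_into_rtranclp\<close>)
  qed blast
  moreover have "D\<^sup>*\<^sup>* \<le> down\<^sup>*\<^sup>*" by (rule rtranclp_mono) (auto simp: D_def)
  ultimately show ?thesis by blast
qed

end

section \<open>A total refinement of the reduction ordering\<close>

text \<open>Polish notation turns terms into words, on which length-lexicographic comparison is
  well-founded, total and compatible with contexts. Letters carry the number of arguments because a
  symbol has no fixed arity in raw terms and the word must be uniquely readable.\<close>

fun preorder_word :: "('f, 's) trm \<Rightarrow> ('s var + 'f \<times> nat) list" where
  "preorder_word (Var x) = [Inl x]"
| "preorder_word (Fun f ts) = Inr (f, length ts) # concat (map preorder_word ts)"

text \<open>No word of a term is a proper prefix of another. The remainders \<open>xs\<close> and
  \<open>ys\<close> let the arguments be read off one by one.\<close>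

lemma preorder_word_append_eq:
  "preorder_word s @ xs = preorder_word t @ ys \<Longrightarrow> s = t \<and> xs = ys"
proof (induction s arbitrary: t xs ys)
  case (Var x)
  then show ?case by (cases t) auto
next
  case (Fun f ss)
  then obtain ts where t: "t = Fun f ts" and len: "length ss = length ts"
    by (cases t) auto
  have "concat (map preorder_word ss) @ xs = concat (map preorder_word ts) @ ys \<Longrightarrow> ss = ts \<and> xs = ys"
    using len Fun.IH
  proof (induction ss ts rule: list_induct2)
    case (Cons s ss t ts)
    have "s = t \<and> concat (map preorder_word ss) @ xs = concat (map preorder_word ts) @ ys"
      using Cons.prems(1)
      by (intro Cons.prems(2)) auto
    then show ?case using Cons.IH Cons.prems(2) by auto
  qed simp
  then show ?case using Fun.prems t by simp
qed

lemma preorder_word_inj: "preorder_word s = preorder_word t \<Longrightarrow> s = t"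
  using preorder_word_append_eq[of s "[]" t "[]"] by simp

text \<open>Putting one word in a context adds a common prefix and a common suffix, which change
  neither the comparison of lengths nor the first difference.\<close>

lemma lenlex_append_cong: "(u, v) \<in> lenlex w \<Longrightarrow> (p @ u @ q, p @ v @ q) \<in> lenlex w"
  by (auto simp: lenlex_conv intro: lex_append_leftI lex_append_rightI)

lemma lenlex_preorder_word_fill:
  "(preorder_word s, preorder_word t) \<in> lenlex w \<Longrightarrow>
    (preorder_word (fill K s), preorder_word (fill K t)) \<in> lenlex w"
proof (induction K)
  case (More f ts K us)
  then show ?case
    using lenlex_append_cong[of _ _ w
        "Inr (f, Suc (length ts + length us)) # concat (map preorder_word ts)"
        "concat (map preorder_word us)"]
    by simp
qed simp

text \<open>The ordering compares ground instances under one fixed grounding substitution. Terms with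
  the same instance are incomparable in \<open>gt\<close>, so ties may be broken by any total monotone
  well-ordering that treats variables as constants.\<close>

lemma total_refinement_exists:
  fixes sig :: "('f, 's) signature"
  assumes inh: "sorts_inhabited sig"
    and red: "reduction_ordering sig gt"
    and tot: "total_on_ground sig gt"
  shows "\<exists>gr. transp_on (wt_terms sig) gr \<and> wfp_on (wt_terms sig) (\<lambda>s t. gr t s) \<and>
    totalp_on (wt_terms sig) gr \<and>
    (\<forall>K s t. fill K s \<in> wt_terms sig \<longrightarrow> fill K t \<in> wt_terms sig \<longrightarrow> gr s t \<longrightarrow>
      gr (fill K s) (fill K t)) \<and>
    (\<forall>s \<in> wt_terms sig. \<forall>t \<in> wt_terms sig. gr s t \<longrightarrow> \<not> ge_of gt t s)"
proof -
  let ?T = "wt_terms sig"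
  obtain \<gamma> :: "('f, 's) subst" where \<gamma>: "\<forall>x. \<gamma> x \<in> ground_terms sig \<and> has_sort sig (\<gamma> x) (snd x)"
    using bchoice[of UNIV "\<lambda>x t. t \<in> ground_terms sig \<and> has_sort sig t (snd x)"] inh
    unfolding sorts_inhabited_def by (simp del: split_paired_All) blast
  have wt\<gamma>: "wt_subst sig \<gamma>" using \<gamma> by (simp add: wt_subst_def del: split_paired_All)
  have ground: "t \<cdot> \<gamma> \<in> ground_terms sig" if "t \<in> ?T" for t
  proof -
    have "vars_term (t \<cdot> \<gamma>) = {}"
      using \<gamma> by (simp add: vars_term_subst ground_terms_def del: split_paired_All)
    then show ?thesis
      using that has_sort_subst[OF wt\<gamma>] by (auto simp: ground_terms_def wt_terms_def)
  qed
  then have wt: "t \<cdot> \<gamma> \<in> ?T" if "t \<in> ?T" for t using that by (simp add: ground_terms_def)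
  have irrefl: "\<not> gt t t" if "t \<in> ?T" for t
    using red that by (auto simp: reduction_ordering_def irreflp_on_def)
  have trans: "transp_on ?T gt" and wfgt: "wfp_on ?T (\<lambda>s t. gt t s)"
    using red by (auto simp: reduction_ordering_def)
  have stable: "gt (s \<cdot> \<gamma>) (t \<cdot> \<gamma>)" if "gt s t" "s \<in> ?T" "t \<in> ?T" for s t
    using red wt\<gamma> that by (auto simp: reduction_ordering_def)
  have gt_fill: "gt (fill K s) (fill K t)" if "gt s t" "fill K s \<in> ?T" "fill K t \<in> ?T" for K s t
    using red that by (auto simp: reduction_ordering_def)
  \<comment> \<open>Any well-ordering of variables and symbols will do, and \<open>w\<close> is its
    strict part. Variables are mere letters here.\<close>
  obtain w0 :: "('s var + 'f \<times> nat) rel" where w0: "Well_order w0" "Field w0 = UNIV"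
    using well_ordering[where 'a = "'s var + 'f \<times> nat"] by (elim exE conjE)
  define w where "w = w0 - Id"
  have w: "wf w" "trans w" "total w"
    using w0 by (auto simp: w_def well_order_on_def linear_order_on_def partial_order_on_def
        preorder_on_def intro: trans_diff_Id)
  let ?word = preorder_word
  define gr where "gr = (\<lambda>s t. gt (s \<cdot> \<gamma>) (t \<cdot> \<gamma>) \<or>
    s \<cdot> \<gamma> = t \<cdot> \<gamma> \<and> (?word t, ?word s) \<in> lenlex w)"
  have lenlex_irrefl: "(u, u) \<notin> lenlex w" for u
    using wf_lenlex[OF w(1)] by auto
  have "transp_on ?T gr"
  proof (rule transp_onI)
    fix s t u
    assume "s \<in> ?T" "t \<in> ?T" "u \<in> ?T" "gr s t" "gr t u"
    then show "gr s u"
      using transp_onD[OF trans wt wt wt, of s t u] transD[OF lenlex_transI[OF w(2)], of "?word u" "?word t" "?word s"]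
      by (auto simp: gr_def)
  qed
  moreover have "wfp_on ?T (\<lambda>s t. gr t s)"
  proof -
    let ?R = "inv_image ({(s, t). gt t s \<and> s \<in> ?T \<and> t \<in> ?T} <*lex*> lenlex w) (\<lambda>s. (s \<cdot> \<gamma>, ?word s))"
    have "wf {(s, t). gt t s \<and> s \<in> ?T \<and> t \<in> ?T}"
      by (rule wfgt[THEN iffD1[OF wfp_on_iff_wfp], THEN iffD1[OF wfp_def]])
    from wf_inv_image[OF wf_lex_prod[OF this wf_lenlex[OF w(1)]]] have "wf ?R" .
    moreover have "{(s, t). gr t s \<and> s \<in> ?T \<and> t \<in> ?T} \<subseteq> ?R"
      by (auto simp: gr_def wt)
    ultimately have "wf {(s, t). gr t s \<and> s \<in> ?T \<and> t \<in> ?T}" by (rule wf_subset)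
    then show ?thesis by (rule iffD2[OF wfp_on_iff_wfp, OF iffD2[OF wfp_def]])
  qed
  moreover have "totalp_on ?T gr"
  proof (rule totalp_onI)
    fix s t
    assume *: "s \<in> ?T" "t \<in> ?T" "s \<noteq> t"
    show "gr s t \<or> gr t s"
    proof (cases "s \<cdot> \<gamma> = t \<cdot> \<gamma>")
      case True
      have "?word s \<noteq> ?word t" using * preorder_word_inj by blast
      then show ?thesis using True total_lenlex[OF w(3)] by (auto simp: gr_def total_on_def)
    next
      case False
      then show ?thesis
        using tot ground * by (auto simp: gr_def total_on_ground_def totalp_on_def)
    qed
  qed
  moreover have "gr (fill K s) (fill K t)" if "fill K s \<in> ?T" "fill K t \<in> ?T" "gr s t" for K s t
  proof -
    have "fill (subst_ctxt K \<gamma>) (s \<cdot> \<gamma>) \<in> ?T" "fill (subst_ctxt K \<gamma>) (t \<cdot> \<gamma>) \<in> ?T"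
      using wt[OF that(1)] wt[OF that(2)] by (simp_all add: subst_fill)
    then show ?thesis
      using that(3) gt_fill lenlex_preorder_word_fill by (auto simp: gr_def subst_fill)
  qed
  \<comment> \<open>By stability \<open>gt t s\<close> would pass to the ground instances, which
    contradicts a strict decrease there as well as a tie.\<close>
  moreover have "\<not> ge_of gt t s" if "s \<in> ?T" "t \<in> ?T" "gr s t" for s t
  proof
    assume "ge_of gt t s"
    then show False
    proof
      assume "gt t s"
      then have "gt (t \<cdot> \<gamma>) (s \<cdot> \<gamma>)" using stable that by blast
      then show False
        using that transp_onD[OF trans wt wt wt, of s t s] irrefl wt by (auto simp: gr_def)
    qed (use that irrefl wt lenlex_irrefl in \<open>auto simp: gr_def\<close>)
  qed
  ultimately show ?thesis by blast
qed

section \<open>Derivations from equations\<close>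

lemma Upair_comm: "Upair s t = Upair t s"
  by simp

lemma subst_clause_equation: "{#Lit p s t#} \<cdot>c \<sigma> = {#Lit p (s \<cdot> \<sigma>) (t \<cdot> \<sigma>)#}"
  by (simp add: subst_clause_def)

lemma vars_clause_equation: "vars_clause {#Lit p s t#} = vars_term s \<union> vars_term t"
  by (simp add: vars_clause_def)

lemma wt_clause_equation:
  "wt_clause sig {#Lit p s t#} \<longleftrightarrow> (\<exists>a. has_sort sig s a \<and> has_sort sig t a)"
  by (auto simp: wt_clause_def wt_literal_def)

lemma is_equation_clause_iff:
  "is_equation_clause sig C \<longleftrightarrow>
    (\<exists>s t a. C = {#Lit True s t#} \<and> has_sort sig s a \<and> has_sort sig t a)"
proof
  show "\<exists>s t a. C = {#Lit True s t#} \<and> has_sort sig s a \<and> has_sort sig t a"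
    if "is_equation_clause sig C"
    using that by (metis is_equation_clause_def wt_clause_equation)
qed (auto simp: is_equation_clause_def wt_clause_equation)

lemma is_equation_clause_fill_clause:
  assumes "is_equation_clause sig (fill_clause E u)"
  obtains K t a where "E = Clause_Ctxt True K t {#}" "has_sort sig (fill K u) a" "has_sort sig t a"
  using assms by (cases E) (auto simp: is_equation_clause_iff)

lemma selected_unit:
  assumes "admissible_selection sig gt sel" "wt_clause sig {#L#}"
  shows "sel {#L#} = {#L#}"
proof -
  have "sel {#L#} \<subseteq># {#L#}" "sel {#L#} \<noteq> {#}"
    using assms by (auto simp: admissible_selection_def)
  then show ?thesis by (cases "sel {#L#}") (auto simp: insert_subset_eq_iff)
qed

lemma rec_derives_mono:
  assumes "N \<subseteq> N'"
  shows "rec_derives sig gt sel N a C \<Longrightarrow> rec_derives sig gt sel N' a C"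
proof (induction rule: rec_derives.induct)
  case (Input C)
  then show ?case using assms by (blast intro: rec_derives.Input)
next
  case Sup
  show ?case by (rule rec_derives.Sup[OF Sup.IH Sup.hyps(3-)])
next
  case EqRes
  show ?case by (rule rec_derives.EqRes[OF EqRes.IH EqRes.hyps(2-)])
next
  case EqFac
  show ?case by (rule rec_derives.EqFac[OF EqFac.IH EqFac.hyps(2-)])
next
  case RwDown
  show ?case by (rule rec_derives.RwDown[OF RwDown.IH RwDown.hyps(3-)])
next
  case RwUp
  show ?case by (rule rec_derives.RwUp[OF RwUp.IH RwUp.hyps(3-)])
qed

lemma rewrite_equation_clause:
  assumes "is_equation_clause sig (fill_clause E (l \<cdot> \<theta>))"
    and "is_equation_clause sig {#Lit True l r#}" and "wt_subst sig \<theta>"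
  shows "is_equation_clause sig (fill_clause E (r \<cdot> \<theta>))"
proof -
  obtain K t a where E: "E = Clause_Ctxt True K t {#}"
    and a: "has_sort sig (fill K (l \<cdot> \<theta>)) a" "has_sort sig t a"
    using assms(1) by (rule is_equation_clause_fill_clause)
  obtain b where "has_sort sig (l \<cdot> \<theta>) b" "has_sort sig (r \<cdot> \<theta>) b"
    using assms(2) has_sort_subst[OF assms(3)]
    unfolding is_equation_clause_def wt_clause_equation by blast
  then have "has_sort sig (fill K (r \<cdot> \<theta>)) a" using has_sort_fill_replace[OF a(1)] by simp
  then show ?thesis using a(2) by (auto simp: E is_equation_clause_def wt_clause_equation)
qed

lemma is_renaming_sort_preserving:
  "is_renaming \<rho> \<Longrightarrow> wt_subst sig \<rho>"
  by (auto simp: is_renaming_def wt_subst_def has_sort_Var simp del: split_paired_All)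

text \<open>(EqRes) needs a negative literal and (EqFac) two positive ones, so neither applies to a
  unit equation. In (Sup), \<open>u\<close> and \<open>l\<close> have a common instance and hence
  the same sort, so the replacement is well-sorted.\<close>

lemma derives_equation:
  assumes "\<forall>C \<in> N. is_equation_clause sig C"
  shows "rec_derives sig gt sel N a C \<Longrightarrow> is_equation_clause sig C"
proof (induction rule: rec_derives.induct)
  case (Sup P Q p K u t C l' r' D' \<rho> l r D \<theta>)
  have P: "p = True" "C = {#}"
    using Sup.IH(1) Sup.hyps(3) by (auto simp: is_equation_clause_def)
  have Q: "D' = {#}"
    using Sup.IH(2) Sup.hyps(5) by (auto simp: is_equation_clause_def)
  obtain a where a: "has_sort sig (fill K u) a" "has_sort sig t a"
    using Sup.IH(1) Sup.hyps(3) P by (auto simp: is_equation_clause_def wt_clause_equation)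
  have \<theta>: "wt_subst sig \<theta>" "l \<cdot> \<theta> = u \<cdot> \<theta>"
    using Sup.hyps by (simp_all add: is_mgu_def is_unifier_def)
  obtain b where b: "has_sort sig l b" "has_sort sig r b"
  proof -
    obtain b where "has_sort sig l' b" "has_sort sig r' b"
      using Sup.IH(2) Sup.hyps(5) Q by (auto simp: is_equation_clause_def wt_clause_equation)
    then show thesis
      using that has_sort_subst[OF is_renaming_sort_preserving[OF Sup.hyps(7)]]
      unfolding Sup.hyps(9,10) by blast
  qed
  obtain c where c: "has_sort sig u c" using has_sort_fill_hole[OF a(1)] by blast
  have "c = b"
    using has_sort_subst[OF \<theta>(1) b(1)] has_sort_subst[OF \<theta>(1) c] \<theta>(2) has_sort_unique by metis
  then have "has_sort sig (fill K r) a" using has_sort_fill_replace[OF a(1) c] b(2) by simp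
  then have "has_sort sig (fill K r \<cdot> \<theta>) a" "has_sort sig (t \<cdot> \<theta>) a"
    using a(2) has_sort_subst[OF \<theta>(1)] by blast+
  then have "is_equation_clause sig ({#Lit True (fill K r) t#} \<cdot>c \<theta>)"
    unfolding subst_clause_equation is_equation_clause_iff by blast
  moreover have "D = {#}" using Sup.hyps Q by (simp add: subst_clause_def)
  ultimately show ?case using P by simp
next
  case (RwDown E l \<theta> r)
  then show ?case by (blast intro: rewrite_equation_clause)
next
  case (RwUp a E l \<theta> r)
  then show ?case by (blast intro: rewrite_equation_clause)
qed (use assms in \<open>auto simp: is_equation_clause_iff\<close>)

section \<open>Plain equations are closed under ordered critical pairs\<close>

locale equational_ReC =
  fixes sig :: "('f, 's) signature"
    and gt :: "('f, 's) trm \<Rightarrow> ('f, 's) trm \<Rightarrow> bool"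
    and sel :: "('f, 's) clause \<Rightarrow> ('f, 's) clause"
    and N :: "('f, 's) clause set"
    and gr :: "('f, 's) trm \<Rightarrow> ('f, 's) trm \<Rightarrow> bool"
  assumes reduction: "reduction_ordering sig gt"
    and selection: "admissible_selection sig gt sel"
    and equations: "\<forall>C \<in> N. is_equation_clause sig C"
    and refinement_trans: "transp_on (wt_terms sig) gr"
    and refinement_wf: "wfp_on (wt_terms sig) (\<lambda>s t. gr t s)"
    and refinement_total: "totalp_on (wt_terms sig) gr"
    and refinement_fill: "fill K s \<in> wt_terms sig \<Longrightarrow> fill K t \<in> wt_terms sig \<Longrightarrow> gr s t \<Longrightarrow>
      gr (fill K s) (fill K t)"
    and refinement_not_ge: "s \<in> wt_terms sig \<Longrightarrow> t \<in> wt_terms sig \<Longrightarrow> gr s t \<Longrightarrow> \<not> ge_of gt t s"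
begin

abbreviation derives :: "annotation \<Rightarrow> ('f, 's) clause \<Rightarrow> bool" where
  "derives \<equiv> rec_derives sig gt sel N"

definition plain_eqs :: "(('f, 's) trm \<times> ('f, 's) trm) set" where
  "plain_eqs = {(l, r). derives Plain {#Lit True l r#}}"

lemma plain_eqs_sort: "(l, r) \<in> plain_eqs \<Longrightarrow> \<exists>a. has_sort sig l a \<and> has_sort sig r a"
  using derives_equation[OF equations, of gt sel Plain "{#Lit True l r#}"]
  by (simp add: plain_eqs_def is_equation_clause_def wt_clause_equation)

lemma plain_eqs_sym: "(l, r) \<in> plain_eqs \<Longrightarrow> (r, l) \<in> plain_eqs"
  by (simp add: plain_eqs_def Upair_comm)

lemma ge_subst:
  "ge_of gt s t \<Longrightarrow> s \<in> wt_terms sig \<Longrightarrow> t \<in> wt_terms sig \<Longrightarrow> wt_subst sig \<delta> \<Longrightarrow>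
    ge_of gt (s \<cdot> \<delta>) (t \<cdot> \<delta>)"
  using reduction by (auto simp: reduction_ordering_def)

text \<open>The lifting lemma: the overlap of two instances is an instance of a (Sup) inference on
  the equations themselves, whose conclusion is the equation sought.\<close>

lemma plain_eqs_superpose:
  assumes eqs: "(fill K u, t) \<in> plain_eqs" "(l, r) \<in> plain_eqs"
    and u: "\<nexists>x. u = Var x"
    and wt: "wt_subst sig \<sigma>" "wt_subst sig \<theta>"
    and overlap: "u \<cdot> \<sigma> = l \<cdot> \<theta>"
    and gr: "gr (l \<cdot> \<theta>) (r \<cdot> \<theta>)" "gr (fill K u \<cdot> \<sigma>) (t \<cdot> \<sigma>)"
  shows "\<exists>p q \<delta>. (p, q) \<in> plain_eqs \<and> wt_subst sig \<delta> \<and>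
    p \<cdot> \<delta> = fill (subst_ctxt K \<sigma>) (r \<cdot> \<theta>) \<and> q \<cdot> \<delta> = t \<cdot> \<sigma>"
proof -
  let ?P = "{#Lit True (fill K u) t#}" and ?Q = "{#Lit True l r#}"
  have derives: "derives Plain ?P" "derives Plain ?Q" using eqs by (auto simp: plain_eqs_def)
  obtain a where a: "has_sort sig (fill K u) a" "has_sort sig t a"
    using plain_eqs_sort[OF eqs(1)] by blast
  obtain b where b: "has_sort sig l b" "has_sort sig r b"
    using plain_eqs_sort[OF eqs(2)] by blast
  have fin: "finite (vars_clause ?P)" "finite (vars_clause ?Q)"
    by (simp_all add: vars_clause_equation finite_vars_term)
  obtain \<pi> :: "'s var \<Rightarrow> 's var" where \<pi>: "bij \<pi>" "\<forall>x. snd (\<pi> x) = snd x"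
    and apart: "vars_clause ?P \<inter> \<pi> ` vars_clause ?Q = {}"
    using renaming_apart[OF fin] by (elim exE conjE)
  define \<rho> :: "('f, 's) subst" where "\<rho> = (\<lambda>x. Var (\<pi> x))"
  have ren: "is_renaming \<rho>" unfolding is_renaming_def \<rho>_def using \<pi> by blast
  note wt\<rho> = is_renaming_sort_preserving[OF ren, of sig]
  have vars: "vars_clause ?P \<inter> vars_clause (?Q \<cdot>c \<rho>) = {}"
    using apart by (auto simp: subst_clause_equation vars_clause_equation vars_term_subst \<rho>_def)
  \<comment> \<open>Once the premises are variable-disjoint, \<open>\<sigma>\<close> and
    \<open>\<theta>\<close> merge into one substitution; on renamed variables
    \<open>\<theta>\<close> is read through the inverse of the renaming.\<close>
  define \<mu> where "\<mu> = (\<lambda>x. if x \<in> vars_clause ?P then \<sigma> x else \<theta> (inv \<pi> x))"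
  have snd_inv: "snd (inv \<pi> x) = snd x" for x
    using \<pi> by (metis bij_inv_eq_iff)
  have wt\<mu>: "wt_subst sig \<mu>"
    unfolding wt_subst_def
  proof
    show "has_sort sig (\<mu> x) (snd x)" for x
      using has_sort_wt_subst[OF wt(1), of x] has_sort_wt_subst[OF wt(2), of "inv \<pi> x"]
      by (simp add: \<mu>_def snd_inv)
  qed
  have left: "s \<cdot> \<mu> = s \<cdot> \<sigma>" if "vars_term s \<subseteq> vars_clause ?P" for s
    using that by (intro subst_cong) (auto simp: \<mu>_def)
  have right: "s \<cdot> \<rho> \<cdot> \<mu> = s \<cdot> \<theta>" if "vars_term s \<subseteq> vars_clause ?Q" for s
    unfolding subst_subst
  proof (rule subst_cong)
    fix x
    assume "x \<in> vars_term s"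
    then have "\<pi> x \<notin> vars_clause ?P" using that apart by blast
    then show "\<rho> x \<cdot> \<mu> = \<theta> x" using \<pi>(1) by (simp add: \<rho>_def \<mu>_def bij_is_inj)
  qed
  have P\<mu>: "fill K u \<cdot> \<mu> = fill K u \<cdot> \<sigma>" "t \<cdot> \<mu> = t \<cdot> \<sigma>"
    using left by (auto simp: vars_clause_equation)
  have ctxt_agree: "subst_ctxt K \<mu> = subst_ctxt K \<sigma>"
    by (intro subst_ctxt_cong[of K u]) (simp add: \<mu>_def vars_clause_equation)
  have "u \<cdot> \<mu> = u \<cdot> \<sigma>"
    using vars_term_fill_hole[of u K] by (intro left) (auto simp: vars_clause_equation)
  moreover have lr\<mu>: "l \<cdot> \<rho> \<cdot> \<mu> = l \<cdot> \<theta>" "r \<cdot> \<rho> \<cdot> \<mu> = r \<cdot> \<theta>"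
    by (simp_all add: right vars_clause_equation)
  ultimately have unifier: "is_unifier sig \<mu> (l \<cdot> \<rho>) u"
    using wt\<mu> overlap by (simp add: is_unifier_def)
  have l\<rho>: "has_sort sig (l \<cdot> \<rho>) b" "has_sort sig (r \<cdot> \<rho>) b"
    by (rule has_sort_subst[OF wt\<rho> b(1)], rule has_sort_subst[OF wt\<rho> b(2)])
  obtain c where c: "has_sort sig u c" using has_sort_fill_hole[OF a(1)] by (elim exE)
  have "c = b"
    using has_sort_unique[OF has_sort_subst[OF wt(1) c]] has_sort_subst[OF wt(2) b(1)] overlap
    by simp
  then obtain \<tau> where \<tau>: "is_mgu sig \<tau> (l \<cdot> \<rho>) u"
    using is_mgu_exists[OF unifier l\<rho>(1)] c by auto
  then obtain \<delta> where \<delta>: "wt_subst sig \<delta>" "\<forall>x. \<mu> x = \<tau> x \<cdot> \<delta>"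
    using unifier unfolding is_mgu_def by meson
  have \<tau>\<delta>: "s \<cdot> \<tau> \<cdot> \<delta> = s \<cdot> \<mu>" for s 
    unfolding subst_subst by (intro subst_cong) (simp add: \<delta>(2) del: split_paired_All)
  have wt\<tau>: "wt_subst sig \<tau>" using \<tau> by (simp add: is_mgu_def is_unifier_def)
  \<comment> \<open>The side conditions of (Sup) concern the mgu, the hypotheses its instance
    \<open>\<mu>\<close>. A violation at the mgu would be inherited by \<open>\<mu>\<close>, since
    \<open>gt\<close> is stable, and there \<open>gr\<close> forbids it.\<close>
  have not_ge: "\<not> ge_of gt (q \<cdot> \<tau>) (p \<cdot> \<tau>)"
    if "gr (p \<cdot> \<mu>) (q \<cdot> \<mu>)" "has_sort sig p d" "has_sort sig q d" for p q d
  proof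
    have *: "p \<cdot> \<tau> \<in> wt_terms sig" "q \<cdot> \<tau> \<in> wt_terms sig"
      "p \<cdot> \<mu> \<in> wt_terms sig" "q \<cdot> \<mu> \<in> wt_terms sig"
      using that(2,3) has_sort_subst[OF wt\<tau>] has_sort_subst[OF wt\<mu>]
      unfolding wt_terms_def by blast+
    assume "ge_of gt (q \<cdot> \<tau>) (p \<cdot> \<tau>)"
    from ge_subst[OF this *(2,1) \<delta>(1)] show False
      using refinement_not_ge[OF *(3,4) that(1)] by (simp add: \<tau>\<delta>)
  qed
  have "derives Plain (add_mset (Lit True (fill K (r \<cdot> \<rho>)) t) ({#} + {#}) \<cdot>c \<tau>)"
  proof (rule rec_derives.Sup[OF derives _ _ _ _ ren vars _ _ _ u \<tau>])
    have "wt_clause sig ?P" "wt_clause sig ?Q"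
      unfolding wt_clause_equation using a b by blast+
    then show "Lit True (fill K u) t \<in># sel ?P" "Lit True l r \<in># sel ?Q"
      by (simp_all add: selected_unit[OF selection])
    show "\<not> ge_of gt (r \<cdot> \<rho> \<cdot> \<tau>) (l \<cdot> \<rho> \<cdot> \<tau>)"
      using not_ge[of "l \<cdot> \<rho>" "r \<cdot> \<rho>"] gr(1) l\<rho> by (simp add: lr\<mu>)
    show "\<not> ge_of gt (t \<cdot> \<tau>) (fill K u \<cdot> \<tau>)"
      using not_ge[of "fill K u" t] gr(2) a by (simp add: P\<mu>)
  qed (simp_all add: subst_clause_def)
  then have "(fill K (r \<cdot> \<rho>) \<cdot> \<tau>, t \<cdot> \<tau>) \<in> plain_eqs"
    by (simp add: plain_eqs_def subst_clause_equation)
  moreover have "fill K (r \<cdot> \<rho>) \<cdot> \<tau> \<cdot> \<delta> = fill (subst_ctxt K \<sigma>) (r \<cdot> \<theta>)"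
    unfolding \<tau>\<delta> unfolding subst_fill by (simp add: ctxt_agree lr\<mu>)
  moreover have "t \<cdot> \<tau> \<cdot> \<delta> = t \<cdot> \<sigma>" by (simp add: \<tau>\<delta> P\<mu>)
  ultimately show ?thesis using \<delta>(1) by blast
qed

sublocale saturated_equations sig plain_eqs gr
  by unfold_locales
    (fact plain_eqs_sort plain_eqs_sym refinement_trans refinement_wf refinement_total
      refinement_fill plain_eqs_superpose)+

section \<open>Valleys as derivations\<close>

lemma derives_down:
  assumes "(s, t) \<in> plain_eqs" "down s s'"
  shows "(s', t) \<in> plain_eqs"
  using assms(2)
proof (cases rule: down.cases)
  case (1 l r \<sigma> K)
  have "\<not> ge_of gt (r \<cdot> \<sigma>) (l \<cdot> \<sigma>)"
    using 1 instance_sort refinement_not_ge by (fastforce simp: wt_terms_def)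
  then have "derives Plain (fill_clause (Clause_Ctxt True K t {#}) (r \<cdot> \<sigma>))"
    by (rule rec_derives.RwDown[where l = l and \<theta> = \<sigma>, rotated 3])
      (use 1 assms(1) in \<open>auto simp: plain_eqs_def\<close>)
  then show ?thesis using 1 by (simp add: plain_eqs_def)
qed

lemma derives_downs:
  assumes "down\<^sup>*\<^sup>* s s'" "(s, t) \<in> plain_eqs"
  shows "(s', t) \<in> plain_eqs"
  using assms(1)
proof (induction rule: rtranclp_induct)
  case (step u v)
  show ?case by (rule derives_down[OF step.IH step.hyps(2)])
qed (rule assms(2))

text \<open>Reversing a downward step gives (RwUp) the very side condition that (RwDown) has for the
  step itself. Upward steps can be chained because the rewritten premise may carry either
  annotation.\<close>

lemma derivable_up:
  assumes "rec_derivable sig gt sel N {#Lit True s t#}" "down s' s"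
  shows "rec_derivable sig gt sel N {#Lit True s' t#}"
  using assms(2)
proof (cases rule: down.cases)
  case (1 l r \<sigma> K)
  have "\<not> ge_of gt (r \<cdot> \<sigma>) (l \<cdot> \<sigma>)"
    using 1 instance_sort refinement_not_ge by (fastforce simp: wt_terms_def)
  moreover obtain a where "derives a (fill_clause (Clause_Ctxt True K t {#}) (r \<cdot> \<sigma>))"
    using assms(1) 1 by (auto simp: rec_derivable_def)
  moreover have "derives Plain {#Lit True r l#}" using plain_eqs_sym 1 by (simp add: plain_eqs_def)
  ultimately have "derives Upward (fill_clause (Clause_Ctxt True K t {#}) (l \<cdot> \<sigma>))"
    using 1 rec_derives.RwUp by blast
  then show ?thesis using 1 by (auto simp: rec_derivable_def)
qed

lemma derivable_ups:
  assumes "down\<^sup>*\<^sup>* s' s" "rec_derivable sig gt sel N {#Lit True s t#}"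
  shows "rec_derivable sig gt sel N {#Lit True s' t#}"
  using assms(1)
proof (induction rule: converse_rtranclp_induct)
  case (step u v)
  show ?case by (rule derivable_up[OF step.IH step.hyps(1)])
qed (rule assms(2))

text \<open>The sides are traced separately to those of one plain equation, which remains available
  as the start of a new derivation.\<close>

definition converts_to_plain :: "('f, 's) clause \<Rightarrow> bool" where
  "converts_to_plain C \<longleftrightarrow>
    (\<exists>s0 t0 s t. (s0, t0) \<in> plain_eqs \<and> C = {#Lit True s t#} \<and> step\<^sup>*\<^sup>* s0 s \<and> step\<^sup>*\<^sup>* t0 t)"

lemma converts_to_plain_rewrite:
  assumes "converts_to_plain (fill_clause E (l \<cdot> \<theta>))" "(l, r) \<in> plain_eqs" "wt_subst sig \<theta>"
  shows "converts_to_plain (fill_clause E (r \<cdot> \<theta>))"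
proof -
  obtain s0 t0 s t where 0: "(s0, t0) \<in> plain_eqs"
    and st: "fill_clause E (l \<cdot> \<theta>) = {#Lit True s t#}" "step\<^sup>*\<^sup>* s0 s" "step\<^sup>*\<^sup>* t0 t"
    using assms(1) unfolding converts_to_plain_def by blast
  obtain K v where E: "E = Clause_Ctxt True K v {#}"
    \<comment> \<open>Equations are unordered, so the rewritten side may descend from either side of
      the plain equation.\<close>
    and cases: "s = fill K (l \<cdot> \<theta>) \<and> t = v \<or> t = fill K (l \<cdot> \<theta>) \<and> s = v"
    using st(1) by (cases E) auto
  have step: "step (fill K (l \<cdot> \<theta>)) (fill K (r \<cdot> \<theta>))"
    using step.intros[OF assms(2,3)] .
  from cases show ?thesis
  proof (elim disjE conjE)
    assume "s = fill K (l \<cdot> \<theta>)" "t = v"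
    then show ?thesis
      unfolding converts_to_plain_def E using 0 st(2,3) step
      by (intro exI[of _ s0] exI[of _ t0] exI[of _ "fill K (r \<cdot> \<theta>)"] exI[of _ v])
        (auto intro: rtranclp.rtrancl_into_rtrancl)
  next
    assume "t = fill K (l \<cdot> \<theta>)" "s = v"
    then show ?thesis
      unfolding converts_to_plain_def E using plain_eqs_sym[OF 0] st(2,3) step
      by (intro exI[of _ t0] exI[of _ s0] exI[of _ "fill K (r \<cdot> \<theta>)"] exI[of _ v])
        (auto intro: rtranclp.rtrancl_into_rtrancl)
  qed
qed

lemma plain_converts_to_plain:
  assumes "derives Plain C"
  shows "converts_to_plain C"
proof -
  obtain s t where "C = {#Lit True s t#}"
    using derives_equation[OF equations assms] by (auto simp: is_equation_clause_def)
  then show ?thesis using assms unfolding converts_to_plain_def plain_eqs_def by blast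
qed

lemma derives_converts_to_plain: "derives a C \<Longrightarrow> converts_to_plain C"
proof (induction rule: rec_derives.induct)
  case Input
  show ?case by (rule plain_converts_to_plain[OF rec_derives.Input[OF Input.hyps]])
next
  case Sup
  show ?case by (rule plain_converts_to_plain[OF rec_derives.Sup[OF Sup.hyps]])
next
  case EqRes
  show ?case by (rule plain_converts_to_plain[OF rec_derives.EqRes[OF EqRes.hyps]])
next
  case EqFac
  show ?case by (rule plain_converts_to_plain[OF rec_derives.EqFac[OF EqFac.hyps]])
next
  case RwDown
  show ?case by (rule plain_converts_to_plain[OF rec_derives.RwDown[OF RwDown.hyps]])
next
  case (RwUp a E l \<theta> r)
  then show ?case by (intro converts_to_plain_rewrite[of E l \<theta> r]) (auto simp: plain_eqs_def)
qed

lemma derivable_if_converts_to_plain: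
  assumes "converts_to_plain C"
  shows "rec_derivable sig gt sel N C"
proof -
  obtain s0 t0 s t where eq: "(s0, t0) \<in> plain_eqs" and C: "C = {#Lit True s t#}"
    and steps: "step\<^sup>*\<^sup>* s0 s" "step\<^sup>*\<^sup>* t0 t"
    using assms unfolding converts_to_plain_def by blast
  obtain a where "has_sort sig s0 a" "has_sort sig t0 a" using plain_eqs_sort[OF eq] by blast
  then obtain u v where u: "down\<^sup>*\<^sup>* s0 u" "down\<^sup>*\<^sup>* s u" and v: "down\<^sup>*\<^sup>* t0 v" "down\<^sup>*\<^sup>* t v"
    using church_rosser steps by metis
  \<comment> \<open>The plain equation descends on both sides to the bottoms of the two valleys;
    from there \<open>s\<close> and \<open>t\<close> are reached by going up.\<close>
  have "(u, v) \<in> plain_eqs"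
    using derives_downs[OF u(1) eq] derives_downs[OF v(1)] plain_eqs_sym by blast
  then have "rec_derivable sig gt sel N {#Lit True u v#}"
    by (auto simp: plain_eqs_def rec_derivable_def)
  then have "rec_derivable sig gt sel N {#Lit True v s#}"
    using derivable_ups[OF u(2)] by (simp add: Upair_comm[of v s])
  then show ?thesis
    using derivable_ups[OF v(2)] C by (simp add: Upair_comm[of s t])
qed

end

theorem theorem2:
  fixes sig :: "('f, 's) signature"
    and gt :: "('f, 's) trm \<Rightarrow> ('f, 's) trm \<Rightarrow> bool"
    and sel :: "('f, 's) clause \<Rightarrow> ('f, 's) clause"
  assumes "sorts_inhabited sig"
    and "reduction_ordering sig gt"
    and "total_on_ground sig gt"
    and "admissible_selection sig gt sel"
  shows "admits_ED sig (rec_derivable sig gt sel)"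
  unfolding admits_ED_def
proof (intro allI impI)
  fix \<theta> :: "('f, 's) subst" and N :: "('f, 's) clause set" and l r D
  assume \<theta>: "wt_subst sig \<theta>" and N: "\<forall>C \<in> N. is_equation_clause sig C"
    and lr: "is_equation_clause sig {#Lit True l r#}"
    and derivable: "rec_derivable sig gt sel N (fill_clause D (l \<cdot> \<theta>))"
  let ?N = "insert {#Lit True l r#} N"
  obtain gr where "transp_on (wt_terms sig) gr" "wfp_on (wt_terms sig) (\<lambda>s t. gr t s)"
      "totalp_on (wt_terms sig) gr"
    and gr: "\<forall>K s t. fill K s \<in> wt_terms sig \<longrightarrow> fill K t \<in> wt_terms sig \<longrightarrow> gr s t \<longrightarrow>
        gr (fill K s) (fill K t)"
      "\<forall>s \<in> wt_terms sig. \<forall>t \<in> wt_terms sig. gr s t \<longrightarrow> \<not> ge_of gt t s"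
    using total_refinement_exists[OF assms(1-3)] by (elim exE conjE)
  then interpret equational_ReC sig gt sel ?N gr
  proof unfold_locales
    show "reduction_ordering sig gt" "admissible_selection sig gt sel" by (rule assms)+
    show "\<forall>C \<in> ?N. is_equation_clause sig C" using N lr by blast
    show "gr (fill K s) (fill K t)"
      if "fill K s \<in> wt_terms sig" "fill K t \<in> wt_terms sig" "gr s t" for K s t
      using gr(1) that by blast
    show "\<not> ge_of gt t s" if "s \<in> wt_terms sig" "t \<in> wt_terms sig" "gr s t" for s t
      using gr(2) that by blast
  qed
  obtain a where "rec_derives sig gt sel ?N a (fill_clause D (l \<cdot> \<theta>))"
    using derivable rec_derives_mono[OF subset_insertI] unfolding rec_derivable_def by blast
  \<comment> \<open>As an input the added equation is plain, so replacing
    \<open>l \<cdot> \<theta>\<close> by \<open>r \<cdot> \<theta>\<close> is one more conversion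
    step, whichever way the instance is oriented.\<close>
  moreover have "(l, r) \<in> plain_eqs" by (simp add: plain_eqs_def rec_derives.Input)
  ultimately show "rec_derivable sig gt sel ?N (fill_clause D (r \<cdot> \<theta>))"
    using \<theta> by (intro derivable_if_converts_to_plain converts_to_plain_rewrite[of D l \<theta> r]
        derives_converts_to_plain)
qed

end
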